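(* Let $n\ge 2$, $1\le d\le n-1$, and $f\in\mathcal{T}'$. Let $w:\mathbb{Z}^n\times\mathbf{Gr}(d,n)\to\mathbb{R}$ be a function such that $$\sum_{A\in\Omega_k}w(k,A)=1,\qquad \Omega_k:=\{A\in\mathbf{Gr}(d,n):k\perp A\},$$ and the series is absolutely convergent for every $k\in\mathbb{Z}^n$. (The weight $w$ does not have to generate a norm or have at most polynomial decay.) Then $$(f,h)=\sum_{A\in\mathbf{Gr}(d,n)}(F_{w(\cdot,A)}R_{d,A}f,h)\qquad\text{for all } h\in C^\infty(\mathbb{T}^n).$$ Moreover, if $f$ has zero average (i.e. $\hat f(0)=0$) and $d=n-1$, then $$f=\sum_{A\in\mathbf{Gr}(d,n)}R_{d,A}f.$$
   Context: Let $\mathbb{T}^n=\mathbb{R}^n/\mathbb{Z}^n$, $\mathcal{T}=C^\infty(\mathbb{T}^n)$, and let $\mathcal{T}'$ be its dual, the space of periodic distributions, with duality pairing $(\cdot,\cdot)$ (so $(f,g)=\int_{\mathbb{T}^n}fg$ for functions). Fourier coefficients are $\hat f(k)=(f,e^{-2\pi i k\cdot x})$, $k\in\mathbb{Z}^n$. $\mathbf{Gr}(d,n)$ is the (countable) set of all $d$-dimensional linear subspaces of $\mathbb{Q}^n$; $k\perp A$ means $k\cdot v=0$ for all $v\in A$. Radon transform: for $f\in\mathcal{T}$ and linearly independent $v_1,\dots,v_d\in\mathbb{Z}^n$, with $A=\{v_1,\dots,v_d\}$, $R_df(x,A)=\int_{[0,1]^d}f(x+t_1v_1+\cdots+t_dv_d)\,dt_1\cdots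 dt_d$. For $f\in\mathcal{T}'$, $R_df(\cdot,A)\in\mathcal{T}'$ is defined by $(R_df(\cdot,A),g)=(f,R_dg(\cdot,A))$ for all $g\in\mathcal{T}$. This depends only on the subspace of $\mathbb{Q}^n$ spanned by $A$, so $R_df(\cdot,A)$ is regarded as defined for $A\in\mathbf{Gr}(d,n)$; write $R_{d,A}f=R_df(\cdot,A)$. For $\omega:\mathbb{Z}^n\to\mathbb{R}$, $F_\omega$ is the Fourier multiplier $\widehat{F_\omega f}(k)=\omega(k)\hat f(k)$. Equality of a distribution with a series of distributions is understood in the sense of distributions, i.e. after pairing with every $h\in C^\infty(\mathbb{T}^n)$.
   Formalization: Added for the first claim, false as printed (sign-changing w can make the series diverge): d=n-1, or w(k,A)≥0 whenever k⊥A, or |f̂(k)|·Σ_{A∈Ω_k}|w(k,A)| grows at most polynomially in k; this is necessary for unordered convergence. *)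

theory Defs
  imports "HOL-Analysis.Analysis"
begin

text \<open>
  The dimension \<open>n\<close> is \<open>CARD('n)\<close>.  Functions on the torus are \<open>\<int>^n\<close>-periodic complex functions
  on \<open>real^'n\<close>; complex values are needed because the characters are test functions.
\<close>

definition of_int_vec :: "int ^ 'n \<Rightarrow> ('a::ring_1) ^ 'n" where
  "of_int_vec k = (\<chi> i. of_int (k $ i))"

definition partial_deriv :: "'n::finite \<Rightarrow> (real ^ 'n \<Rightarrow> complex) \<Rightarrow> (real ^ 'n \<Rightarrow> complex)" where
  "partial_deriv i f = (\<lambda>x. frechet_derivative f (at x) (axis i 1))"

definition iter_partial :: "'n::finite list \<Rightarrow> (real ^ 'n \<Rightarrow> complex) \<Rightarrow> (real ^ 'n \<Rightarrow> complex)" where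
  "iter_partial is f = foldr partial_deriv is f"

definition smooth :: "(real ^ 'n::finite \<Rightarrow> complex) \<Rightarrow> bool" where
  "smooth f \<longleftrightarrow> (\<forall>is x. iter_partial is f differentiable (at x))"

definition test_functions :: "(real ^ 'n::finite \<Rightarrow> complex) set" where
  "test_functions = {f. smooth f \<and> (\<forall>x m. f (x + of_int_vec m) = f x)}"

text \<open>
  The dual of \<open>C^\<infinity>\<close> of the torus, with its usual topology given by the seminorms
  \<open>\<phi> \<mapsto> sup \<bar>\<partial>^\<alpha> \<phi>\<bar>\<close>.  The elements are made extensional, so that two periodic distributions are
  equal as HOL functions iff they agree on all test functions.
\<close>
definition periodic_distributions :: "((real ^ 'n::finite \<Rightarrow> complex) \<Rightarrow> complex) set" where
  "periodic_distributions = {u \<in> extensional test_functions.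
     (\<forall>\<phi>\<in>test_functions. \<forall>\<psi>\<in>test_functions. u (\<lambda>x. \<phi> x + \<psi> x) = u \<phi> + u \<psi>) \<and>
     (\<forall>c. \<forall>\<phi>\<in>test_functions. u (\<lambda>x. c * \<phi> x) = c * u \<phi>) \<and>
     (\<exists>C N. \<forall>\<phi>\<in>test_functions.
        cmod (u \<phi>) \<le> C * (\<Sum>is\<in>{is. length is \<le> N}. SUP x. cmod (iter_partial is \<phi> x)))}"

definition fourier_coeff ::
  "((real ^ 'n::finite \<Rightarrow> complex) \<Rightarrow> complex) \<Rightarrow> int ^ 'n \<Rightarrow> complex" where
  "fourier_coeff u k = u (\<lambda>x. exp (- 2 * of_real pi * \<i> * of_real (of_int_vec k \<bullet> x)))"

definition Gr :: "nat \<Rightarrow> (rat ^ 'n::finite) set set" where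
  "Gr d = {A. vec.subspace A \<and> vec.dim A = d}"

definition perp :: "int ^ 'n::finite \<Rightarrow> (rat ^ 'n) set \<Rightarrow> bool" where
  "perp k A \<longleftrightarrow> (\<forall>v\<in>A. (\<Sum>i\<in>UNIV. of_int (k $ i) * v $ i) = 0)"

definition \<Omega> :: "nat \<Rightarrow> int ^ 'n::finite \<Rightarrow> (rat ^ 'n) set set" where
  "\<Omega> d k = {A \<in> Gr d. perp k A}"

text \<open>Only the values \<open>v 0, \<dots>, v (d - 1)\<close> of \<open>v\<close> are relevant.\<close>
definition integer_basis :: "nat \<Rightarrow> (nat \<Rightarrow> int ^ 'n::finite) \<Rightarrow> (rat ^ 'n) set \<Rightarrow> bool" where
  "integer_basis d v A \<longleftrightarrow>
     inj_on v {..<d} \<and>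
     vec.independent ((\<lambda>i. of_int_vec (v i)) ` {..<d} :: (rat ^ 'n) set) \<and>
     vec.span ((\<lambda>i. of_int_vec (v i)) ` {..<d}) = A"

definition radon_fun ::
  "nat \<Rightarrow> (nat \<Rightarrow> int ^ 'n::finite) \<Rightarrow> (real ^ 'n \<Rightarrow> complex) \<Rightarrow> (real ^ 'n \<Rightarrow> complex)" where
  "radon_fun d v f = (\<lambda>x.
     LINT t:({..<d} \<rightarrow>\<^sub>E {0..1})|(\<Pi>\<^sub>M i\<in>{..<d}. lborel). f (x + (\<Sum>i<d. t i *\<^sub>R of_int_vec (v i))))"

text \<open>On distributions, by duality; the choice of the integer basis of \<open>A\<close> does not matter.\<close>
definition radon ::
  "nat \<Rightarrow> (rat ^ 'n::finite) set \<Rightarrow> ((real ^ 'n \<Rightarrow> complex) \<Rightarrow> complex) \<Rightarrow>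
   ((real ^ 'n \<Rightarrow> complex) \<Rightarrow> complex)" where
  "radon d A u = (\<lambda>g\<in>test_functions. u (radon_fun d (SOME v. integer_basis d v A) g))"

text \<open>
  For an arbitrary symbol \<open>\<omega>\<close> the sequence \<open>\<omega>(k) \<cdot> fourier_coeff u k\<close> need not be the sequence of Fourier
  coefficients of a distribution, so \<open>F\<^sub>\<omega> u\<close> is given by a relation (\<open>U\<close> is \<open>F\<^sub>\<omega> u\<close>) and by a
  description, which is meaningful only if such a \<open>U\<close>, necessarily unique, exists.
\<close>
definition is_fourier_multiplier ::
  "(int ^ 'n::finite \<Rightarrow> real) \<Rightarrow> ((real ^ 'n \<Rightarrow> complex) \<Rightarrow> complex) \<Rightarrow>
   ((real ^ 'n \<Rightarrow> complex) \<Rightarrow> complex) \<Rightarrow> bool" where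
  "is_fourier_multiplier \<omega> u U \<longleftrightarrow>
     U \<in> periodic_distributions \<and> (\<forall>k. fourier_coeff U k = of_real (\<omega> k) * fourier_coeff u k)"

definition fourier_multiplier ::
  "(int ^ 'n::finite \<Rightarrow> real) \<Rightarrow> ((real ^ 'n \<Rightarrow> complex) \<Rightarrow> complex) \<Rightarrow>
   ((real ^ 'n \<Rightarrow> complex) \<Rightarrow> complex)" where
  "fourier_multiplier \<omega> u = (THE U. is_fourier_multiplier \<omega> u U)"

definition polynomial_growth :: "(int ^ 'n::finite \<Rightarrow> real) \<Rightarrow> bool" where
  "polynomial_growth a \<longleftrightarrow>
     (\<exists>C N. \<forall>k. \<bar>a k\<bar> \<le> C * (1 + norm (of_int_vec k :: real ^ 'n)) ^ (N::nat))"

text \<open>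
  Condition for the series of the \<open>F\<^bsub>w(\<cdot>,A)\<^esub> R\<^bsub>d,A\<^esub> u\<close> to make sense: a weight that takes both signs may
  have cancelling values of arbitrary size at each \<open>k\<close>, and then the series can diverge.  Nothing is
  required of nonnegative weights, nor in codimension one.  In the other cases the condition is
  necessary: apply the uniform boundedness principle to the finite partial sums of the series.
\<close>
definition admissible_weight ::
  "nat \<Rightarrow> (int ^ 'n::finite \<Rightarrow> (rat ^ 'n) set \<Rightarrow> real) \<Rightarrow> ((real ^ 'n \<Rightarrow> complex) \<Rightarrow> complex) \<Rightarrow> bool" where
  "admissible_weight d w u \<longleftrightarrow>
     d = CARD('n) - 1 \<or>
     (\<forall>k. \<forall>A\<in>\<Omega> d k. 0 \<le> w k A) \<or>
     polynomial_growth (\<lambda>k. cmod (fourier_coeff u k) * (\<Sum>\<^sub>\<infinity>A\<in>\<Omega> d k. \<bar>w k A\<bar>))"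

end

theory Submission
  imports Defs
begin

text \<open>
  On the character of frequency \<open>k\<close> the Radon transform along \<open>A\<close> acts as multiplication by \<open>1\<close> if
  \<open>k \<bottom> A\<close> and by \<open>0\<close> otherwise, so the \<open>A\<close>-th term of the series has the Fourier coefficients
  \<open>w(k,A) \<cdot> fourier_coeff f k\<close> for \<open>k \<bottom> A\<close> and \<open>0\<close> elsewhere.  Each admissibility condition
  forces \<open>\<bar>fourier_coeff f k\<bar> \<cdot> (\<Sum>A. \<bar>w(k,A)\<bar>)\<close> to grow at most polynomially.  Since the Fourier
  coefficients of a test function decay rapidly, the double series over \<open>k\<close> and \<open>A\<close> converges
  absolutely, and summing over \<open>A\<close> first gives the Fourier series of \<open>f\<close>.  In codimension one a
  frequency \<open>k \<noteq> 0\<close> is orthogonal to at most one subspace, its own orthogonal complement, so that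
  weights can be dropped as soon as the frequency \<open>0\<close> does not contribute.

  Uniqueness of Fourier coefficients comes from the Stone-Weierstrass theorem on the product of
  circles, and the Radon transform is treated as an iteration of one-dimensional averages.
\<close>

section \<open>Characters and test functions\<close>

text \<open>The exponent has the opposite sign to the one in \<open>fourier_coeff\<close>;
  \<open>fourier_coeff_eq\<close> records the flip, which is the source of every \<open>- k\<close>
  below.\<close>

definition character :: "int ^ 'n::finite \<Rightarrow> real ^ 'n \<Rightarrow> complex" where
  "character k x = exp (2 * of_real pi * \<i> * of_real (of_int_vec k \<bullet> x))"

lemma of_int_vec_nth [simp]: "of_int_vec k $ i = of_int (k $ i)"
  by (simp add: of_int_vec_def)

lemma of_int_vec_add: "of_int_vec (k + l) = of_int_vec k + of_int_vec l"
  by (simp add: vec_eq_iff)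

lemma of_int_vec_minus: "of_int_vec (- k) = - of_int_vec k"
  by (simp add: vec_eq_iff)

lemma of_int_vec_0 [simp]: "of_int_vec 0 = 0"
  unfolding vec_eq_iff by simp

lemma of_int_vec_axis: "of_int_vec (axis i 1) = axis i 1"
  by (simp add: vec_eq_iff axis_def)

lemma inner_of_int_vec: "(of_int_vec k :: real ^ 'n::finite) \<bullet> of_int_vec m = of_int (\<Sum>i\<in>UNIV. k $ i * m $ i)"
  by (simp add: inner_vec_def)

lemma character_add: "character (k + l) x = character k x * character l x"
  by (simp add: character_def of_int_vec_add inner_add_left distrib_left exp_add)

lemma character_0 [simp]: "character 0 x = 1"
  by (simp add: character_def)

lemma norm_character [simp]: "cmod (character k x) = 1"
  by (simp add: character_def norm_exp_eq_Re)

lemma exp_2pi_int: "exp (2 * of_real pi * \<i> * of_int m) = 1"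
  using exp_integer_2pi[of "of_int m"] by (simp add: mult_ac)

lemma character_shift: "character k (x + y) = character k x * character k y"
  by (simp add: character_def inner_add_right distrib_left exp_add)

lemma character_of_int_vec: "character k (of_int_vec m) = 1"
  unfolding character_def inner_of_int_vec of_real_of_int_eq by (rule exp_2pi_int)

lemma character_has_derivative:
  "(character k has_derivative
     (\<lambda>v. 2 * of_real pi * \<i> * of_real (of_int_vec k \<bullet> v) * character k x)) (at x)"
proof -
  have "((\<lambda>x. 2 * of_real pi * \<i> * complex_of_real (of_int_vec k \<bullet> x)) has_derivative
      (\<lambda>v. 2 * of_real pi * \<i> * of_real (of_int_vec k \<bullet> v))) (at x)"
    by (auto intro!: derivative_eq_intros)
  from has_derivative_compose[OF this DERIV_exp[unfolded has_field_derivative_def]]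
  show ?thesis
    unfolding character_def by (simp add: mult.commute)
qed

lemma fourier_coeff_eq: "fourier_coeff u k = u (character (- k))"
  unfolding fourier_coeff_def
  by (rule arg_cong[of _ _ u]) (simp add: fun_eq_iff character_def of_int_vec_minus)

section \<open>Iterated partial derivatives and closure properties of test functions\<close>

lemma iter_partial_Nil [simp]: "iter_partial [] f = f"
  and iter_partial_Cons: "iter_partial (i # is) f = partial_deriv i (iter_partial is f)"
  and iter_partial_append: "iter_partial (is @ js) f = iter_partial is (iter_partial js f)"
  by (simp_all add: iter_partial_def)

lemma partial_deriv_eq:
  assumes "(f has_derivative f') (at x)"
  shows "partial_deriv i f x = f' (axis i 1)"
  using frechet_derivative_at[OF assms] by (simp add: partial_deriv_def)

lemma character_differentiable: "character k differentiable (at x)"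
  using character_has_derivative differentiable_def by blast

lemma partial_deriv_add:
  assumes "f differentiable (at x)" "g differentiable (at x)"
  shows "partial_deriv i (\<lambda>x. f x + g x) x = partial_deriv i f x + partial_deriv i g x"
  by (rule trans[OF partial_deriv_eq[OF has_derivative_add]])
     (use assms in \<open>auto simp: frechet_derivative_works[symmetric] partial_deriv_def\<close>)

lemma partial_deriv_cmult:
  assumes "f differentiable (at x)"
  shows "partial_deriv i (\<lambda>x. c * f x) x = c * partial_deriv i f x"
  by (rule trans[OF partial_deriv_eq[OF has_derivative_mult_right]])
     (use assms in \<open>auto simp: frechet_derivative_works[symmetric] partial_deriv_def\<close>)

lemma partial_deriv_character:
  "partial_deriv i (character k) = (\<lambda>x. (2 * of_real pi * \<i> * of_int (k $ i)) * character k x)"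
  by (rule ext, rule trans[OF partial_deriv_eq[OF character_has_derivative]])
     (simp add: inner_axis)

lemma smooth_partial_deriv:
  assumes "smooth f" shows "smooth (partial_deriv i f)"
  unfolding smooth_def
proof (intro allI)
  fix "is" x
  have "iter_partial is (partial_deriv i f) = iter_partial (is @ [i]) f"
    by (simp add: iter_partial_append iter_partial_Cons)
  then show "iter_partial is (partial_deriv i f) differentiable at x"
    using assms unfolding smooth_def by presburger
qed

lemma iter_partial_add:
  assumes "smooth f" "smooth g"
  shows "iter_partial is (\<lambda>x. f x + g x) = (\<lambda>x. iter_partial is f x + iter_partial is g x)"
  by (induction "is") (use assms in \<open>auto simp: iter_partial_Cons smooth_def intro!: ext partial_deriv_add\<close>)

lemma iter_partial_cmult:
  assumes "smooth f"
  shows "iter_partial is (\<lambda>x. c * f x) = (\<lambda>x. c * iter_partial is f x)"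
  by (induction "is") (use assms in \<open>auto simp: iter_partial_Cons smooth_def intro!: ext partial_deriv_cmult\<close>)

lemma smooth_add: "smooth f \<Longrightarrow> smooth g \<Longrightarrow> smooth (\<lambda>x. f x + g x)"
  by (simp add: smooth_def iter_partial_add)

lemma smooth_cmult: "smooth f \<Longrightarrow> smooth (\<lambda>x. c * f x)"
  by (simp add: smooth_def iter_partial_cmult)

lemma iter_partial_character:
  "iter_partial is (character k) =
     (\<lambda>x. (\<Prod>i\<leftarrow>is. 2 * of_real pi * \<i> * of_int (k $ i)) * character k x)"
proof (induction "is")
  case (Cons i "is")
  have "iter_partial (i # is) (character k) x =
      (\<Prod>i\<leftarrow>i # is. 2 * of_real pi * \<i> * of_int (k $ i)) * character k x" for x
    unfolding iter_partial_Cons Cons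
    by (subst partial_deriv_cmult[OF character_differentiable]) (simp add: partial_deriv_character)
  then show ?case by (rule ext)
qed simp

lemma test_functions_add: "f \<in> test_functions \<Longrightarrow> g \<in> test_functions \<Longrightarrow> (\<lambda>x. f x + g x) \<in> test_functions"
  by (simp add: test_functions_def smooth_add)

lemma test_functions_cmult: "f \<in> test_functions \<Longrightarrow> (\<lambda>x. c * f x) \<in> test_functions"
  by (simp add: test_functions_def smooth_cmult)

lemma character_test [simp]: "character k \<in> test_functions"
proof -
  have "iter_partial is (character k) differentiable (at x)" for "is" x
    unfolding iter_partial_character
    by (intro differentiable_mult character_differentiable differentiable_const)
  then show ?thesis
    by (simp add: test_functions_def smooth_def character_shift character_of_int_vec)
qed

lemma test_functions_sum:
  assumes "\<And>k. k \<in> K \<Longrightarrow> g k \<in> test_functions"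
  shows "(\<lambda>x. \<Sum>k\<in>K. g k x) \<in> test_functions"
proof (cases "finite K")
  case True
  have zero: "(\<lambda>x. 0) \<in> test_functions"
    using test_functions_cmult[OF character_test, of 0] by simp
  show ?thesis
    using True assms by (induction) (auto simp: zero intro: test_functions_add)
next
  \<comment> \<open>Here the finite-sum operator returns its default value 0, and the zero function
    is a multiple of a character.\<close>
  case False
  then show ?thesis
    using test_functions_cmult[OF character_test, of 0] by simp
qed

text \<open>Expanding the direction in the standard basis makes the dependence of the derivative on
  the base point explicit, through partial derivatives that are test functions themselves.\<close>

lemma test_has_derivative:
  assumes "f \<in> test_functions"
  shows "(f has_derivative (\<lambda>v. \<Sum>i\<in>UNIV. of_real (v $ i) * partial_deriv i f x)) (at x)"
proof -
  have "iter_partial [] f differentiable (at x)"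
    using assms unfolding test_functions_def smooth_def by blast
  then have D: "(f has_derivative frechet_derivative f (at x)) (at x)"
    by (simp add: frechet_derivative_works)
  then interpret linear "frechet_derivative f (at x)"
    by (rule has_derivative_linear)
  have "frechet_derivative f (at x) v = (\<Sum>i\<in>UNIV. of_real (v $ i) * partial_deriv i f x)" for v
  proof -
    have "frechet_derivative f (at x) v = frechet_derivative f (at x) (\<Sum>i\<in>UNIV. (v $ i) *\<^sub>R axis i 1)"
      using basis_expansion[of v] by (simp add: scalar_mult_eq_scaleR)
    also have "\<dots> = (\<Sum>i\<in>UNIV. of_real (v $ i) * partial_deriv i f x)"
      by (simp add: sum scale partial_deriv_def flip: scaleR_conv_of_real)
    finally show ?thesis .
  qed
  then have "frechet_derivative f (at x) = (\<lambda>v. \<Sum>i\<in>UNIV. of_real (v $ i) * partial_deriv i f x)"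
    by blast
  with D show ?thesis by simp
qed

lemma test_partial_deriv:
  assumes "f \<in> test_functions" shows "partial_deriv i f \<in> test_functions"
proof -
  have per: "f (x + of_int_vec m) = f x" for x m
    using assms by (simp add: test_functions_def)
  have "partial_deriv i f (x + of_int_vec m) = partial_deriv i f x" for x m
  proof -
    \<comment> \<open>By the chain rule the translate of \<open>f\<close> has at \<open>x\<close>
      the derivative of \<open>f\<close> at the translated point. The translate is \<open>f\<close>
      itself, so the partial derivatives at both points agree.\<close>
    have "((\<lambda>x. f (x + of_int_vec m)) has_derivative
        (\<lambda>v. \<Sum>j\<in>UNIV. of_real (v $ j) * partial_deriv j f (x + of_int_vec m))) (at x)"
      by (rule has_derivative_compose[OF _ test_has_derivative[OF assms], of "\<lambda>x. x + of_int_vec m" "\<lambda>v. v"])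
         (auto intro!: derivative_eq_intros)
    then have "(f has_derivative
        (\<lambda>v. \<Sum>j\<in>UNIV. of_real (v $ j) * partial_deriv j f (x + of_int_vec m))) (at x)"
      by (simp add: per)
    from partial_deriv_eq[OF this, of i] show ?thesis
      by (simp add: axis_def if_distrib if_distribR sum.delta cong: if_cong)
  qed
  then show ?thesis
    using assms smooth_partial_deriv by (auto simp: test_functions_def)
qed

lemma test_iter_partial: "f \<in> test_functions \<Longrightarrow> iter_partial is f \<in> test_functions"
  by (induction "is") (auto simp: iter_partial_Cons test_partial_deriv)

lemma test_continuous: "f \<in> test_functions \<Longrightarrow> continuous_on S f"
  by (rule continuous_on_subset[of UNIV])
     (auto intro!: has_derivative_continuous_on[OF has_derivative_at_withinI, OF test_has_derivative])

lemma test_periodic: "f \<in> test_functions \<Longrightarrow> f (x + of_int_vec m) = f x"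
  by (simp add: test_functions_def)

section \<open>Boundedness and the seminorms of test functions\<close>

lemma box_representative:
  obtains m where "x + of_int_vec m \<in> cbox 0 (1 :: real ^ 'n::finite)"
proof
  \<comment> \<open>Subtracting the integer part of every coordinate moves the point into the
    cube.\<close>
  show "x + of_int_vec (\<chi> i. - \<lfloor>x $ i\<rfloor>) \<in> cbox 0 1"
    by (auto simp: mem_box_cart) linarith+
qed

lemma test_bounded:
  assumes "f \<in> test_functions"
  shows "bdd_above (range (\<lambda>x. cmod (f x)))"
proof -
  have "compact (f ` cbox 0 1)"
    by (intro compact_continuous_image test_continuous assms compact_cbox)
  then have "bounded (f ` cbox 0 1)"
    by (rule compact_imp_bounded)
  then obtain B where B: "\<And>x. x \<in> cbox 0 1 \<Longrightarrow> cmod (f x) \<le> B"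
    by (auto simp: bounded_iff)
  have "cmod (f x) \<le> B" for x
    by (metis B test_periodic[OF assms] box_representative)
  then show ?thesis
    by (rule bdd_aboveI2)
qed

definition sup_norm :: "(real ^ 'n::finite \<Rightarrow> complex) \<Rightarrow> real" where
  "sup_norm f = (SUP x. cmod (f x))"

lemma sup_norm_ge: "f \<in> test_functions \<Longrightarrow> cmod (f x) \<le> sup_norm f"
  unfolding sup_norm_def by (rule cSUP_upper[OF _ test_bounded]) auto

lemma sup_norm_le: "(\<And>x. cmod (f x) \<le> B) \<Longrightarrow> sup_norm f \<le> B"
  unfolding sup_norm_def by (rule cSUP_least) auto

lemma sup_norm_nonneg: "f \<in> test_functions \<Longrightarrow> 0 \<le> sup_norm f"
  using order_trans[OF norm_ge_zero sup_norm_ge] .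

text \<open>The bound in the continuity condition of \<open>periodic_distributions\<close>. Since
  lists replace multi-indices, a mixed derivative is counted once for every order of
  differentiation.\<close>

definition seminorm :: "nat \<Rightarrow> (real ^ 'n::finite \<Rightarrow> complex) \<Rightarrow> real" where
  "seminorm N f = (\<Sum>is\<in>{is. length is \<le> N}. sup_norm (iter_partial is f))"

lemma finite_short_lists: "finite {is :: 'n::finite list. length is \<le> N}"
  using finite_lists_length_le[of "UNIV :: 'n set" N] by simp

lemma seminorm_ge:
  assumes "f \<in> test_functions" "length is \<le> N"
  shows "sup_norm (iter_partial is f) \<le> seminorm N f"
  unfolding seminorm_def
  by (rule member_le_sum) (use assms in \<open>auto simp: finite_short_lists intro: sup_norm_nonneg test_iter_partial\<close>)

lemma seminorm_nonneg: "f \<in> test_functions \<Longrightarrow> 0 \<le> seminorm N f"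
  unfolding seminorm_def by (intro sum_nonneg sup_norm_nonneg test_iter_partial)

section \<open>Fourier coefficients of test functions\<close>

definition torus_integral :: "(real ^ 'n::finite \<Rightarrow> complex) \<Rightarrow> complex" where
  "torus_integral f = integral (cbox 0 1) f"

text \<open>Coefficients of functions, as opposed to \<open>fourier_coeff\<close>, which acts on
  functionals.\<close>

definition fourier_transform :: "(real ^ 'n::finite \<Rightarrow> complex) \<Rightarrow> int ^ 'n \<Rightarrow> complex" where
  "fourier_transform f k = torus_integral (\<lambda>x. f x * character (- k) x)"

text \<open>
  The box is cut at heights \<open>s\<close> and \<open>1\<close> in direction \<open>i\<close>; periodicity matches the two outer slabs.
\<close>
lemma integral_shift_periodic:
  fixes g :: "real ^ 'n::finite \<Rightarrow> complex"
  assumes cont: "continuous_on UNIV g"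
    and per: "\<And>x. g (x + axis i 1) = g x"
    and s: "0 \<le> s" "s \<le> 1"
  shows "integral (cbox 0 1) (\<lambda>x. g (x + s *\<^sub>R axis i 1)) = integral (cbox 0 1) g"
proof -
  let ?e = "axis i 1 :: real ^ 'n"
  have e: "?e \<in> Basis" by (simp add: axis_in_Basis_iff)
  have int: "g integrable_on cbox a b" for a b
    by (rule integrable_continuous) (rule continuous_on_subset[OF cont], simp)
  have shift: "integral (cbox a b) (\<lambda>x. g (x + c)) = integral (cbox (a + c) (b + c)) g" for a b c
    using integral_shift_cbox_plus[of a b g c] by (simp add: o_def add.commute[of c])
  have split: "integral (cbox 0 (1 + s *\<^sub>R ?e)) g =
     integral (cbox 0 (1 + s *\<^sub>R ?e) \<inter> {x. x \<bullet> ?e \<le> c}) g +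
     integral (cbox 0 (1 + s *\<^sub>R ?e) \<inter> {x. x \<bullet> ?e \<ge> c}) g" for c
    by (rule integral_split[OF int e])
  have nth: "x \<bullet> ?e = x $ i" for x by (simp add: inner_axis)
  have m: "?e $ j = (if j = i then 1 else 0)" for j by (simp add: axis_def)
  have lower: "cbox a b \<inter> {x. x $ i \<le> c} = cbox a (\<chi> j. if j = i then min (b $ j) c else b $ j)"
    and upper: "cbox a b \<inter> {x. x $ i \<ge> c} = cbox (\<chi> j. if j = i then max (a $ j) c else a $ j) b"
    for a b :: "real ^ 'n" and c
    by (auto simp: mem_box_cart split: if_splits)
  have A1: "cbox 0 (1 + s *\<^sub>R ?e) \<inter> {x. x \<bullet> ?e \<le> s} = cbox 0 (1 + (s - 1) *\<^sub>R ?e)"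
    and A2: "cbox 0 (1 + s *\<^sub>R ?e) \<inter> {x. x \<bullet> ?e \<ge> s} = cbox (0 + s *\<^sub>R ?e) (1 + s *\<^sub>R ?e)"
    and A3: "cbox 0 (1 + s *\<^sub>R ?e) \<inter> {x. x \<bullet> ?e \<le> 1} = cbox 0 1"
    and A4: "cbox 0 (1 + s *\<^sub>R ?e) \<inter> {x. x \<bullet> ?e \<ge> 1} = cbox (0 + ?e) (1 + (s - 1) *\<^sub>R ?e + ?e)"
    unfolding nth lower upper
    by (rule arg_cong2[of _ _ _ _ cbox]; use s in \<open>simp add: vec_eq_iff m\<close>)+
  have "integral (cbox (0 + ?e) (1 + (s - 1) *\<^sub>R ?e + ?e)) g = integral (cbox 0 (1 + (s - 1) *\<^sub>R ?e)) g"
    using shift[of 0 "1 + (s - 1) *\<^sub>R ?e" ?e] by (simp add: per)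
  with split[of s] split[of 1] show ?thesis
    unfolding A1 A2 A3 A4 shift by simp
qed

text \<open>Translating \<open>g\<close> by \<open>s\<close> in direction \<open>i\<close> does not
  change its integral over the cube. Differentiating this constant function of \<open>s\<close> at 0
  under the integral sign gives the integral of the partial derivative. The derivative is one-sided
  because \<open>s\<close> ranges over the unit interval.\<close>

lemma integral_partial_deriv_periodic:
  fixes g :: "real ^ 'n::finite \<Rightarrow> complex"
  assumes deriv: "\<And>x. (g has_derivative g' x) (at x)"
    and cont': "continuous_on UNIV (\<lambda>x. g' x (axis i 1))"
    and per: "\<And>x. g (x + axis i 1) = g x"
  shows "integral (cbox 0 1) (\<lambda>x. g' x (axis i 1)) = 0"
proof -
  let ?e = "axis i 1 :: real ^ 'n"
  let ?I = "\<lambda>s. integral (cbox 0 1) (\<lambda>x. g (x + s *\<^sub>R ?e))"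
  have cont: "continuous_on S g" for S
    by (rule has_derivative_continuous_on[OF has_derivative_at_withinI, OF deriv])
  have "(?I has_vector_derivative integral (cbox 0 1) (\<lambda>x. g' (x + 0 *\<^sub>R ?e) ?e)) (at 0 within {0..1})"
  proof (rule leibniz_rule_vector_derivative)
    fix s :: real and x
    have "((\<lambda>s. x + s *\<^sub>R ?e) has_derivative (\<lambda>s. s *\<^sub>R ?e)) (at s within {0..1})"
      by (auto intro!: derivative_eq_intros)
    from has_derivative_compose[OF this deriv]
    have "((\<lambda>s. g (x + s *\<^sub>R ?e)) has_derivative (\<lambda>t. g' (x + s *\<^sub>R ?e) (t *\<^sub>R ?e))) (at s within {0..1})" .
    then show "((\<lambda>s. g (x + s *\<^sub>R ?e)) has_vector_derivative g' (x + s *\<^sub>R ?e) ?e) (at s within {0..1})"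
      using linear_scale[OF has_derivative_linear[OF deriv]] by (simp add: has_vector_derivative_def)
  next
    show "(\<lambda>x. g (x + s *\<^sub>R ?e)) integrable_on cbox 0 1" for s
      by (intro integrable_continuous continuous_on_compose2[OF cont[of UNIV]] continuous_intros) auto
    show "continuous_on ({0..1} \<times> cbox 0 1) (\<lambda>(s, x). g' (x + s *\<^sub>R ?e) ?e)"
      unfolding case_prod_unfold
      by (intro continuous_on_compose2[OF cont'] continuous_intros) auto
  qed auto
  moreover have "(?I has_vector_derivative 0) (at 0 within {0..1})"
    by (rule has_vector_derivative_transform[of _ _ _ "\<lambda>_. integral (cbox 0 1) g"])
       (use integral_shift_periodic[OF cont per] in auto)
  \<comment> \<open>The point 0 is a limit point of the interval, so derivatives within it are
    unique.\<close>
  moreover have "at (0::real) within {0..1} \<noteq> bot"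
    by (simp add: at_within_Icc_at_right)
  ultimately have "integral (cbox 0 1) (\<lambda>x. g' (x + 0 *\<^sub>R ?e) ?e) = 0"
    using vector_derivative_unique_within by blast
  then show ?thesis by simp
qed

section \<open>Elementary estimates and the effect of derivatives on Fourier coefficients\<close>

lemma test_integrable:
  assumes "f \<in> test_functions"
  shows "(\<lambda>x. f x * character k x) integrable_on cbox a b"
  by (intro integrable_continuous continuous_intros test_continuous assms character_test)

lemma fourier_transform_add:
  assumes "f \<in> test_functions" "g \<in> test_functions"
  shows "fourier_transform (\<lambda>x. f x + g x) k = fourier_transform f k + fourier_transform g k"
  unfolding fourier_transform_def torus_integral_def
  by (simp add: distrib_right integral_add assms test_integrable)

lemma fourier_transform_cmult: "fourier_transform (\<lambda>x. c * f x) k = c * fourier_transform f k"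
  unfolding fourier_transform_def torus_integral_def
  by (simp add: mult.assoc)

lemma content_unit_cube: "measure lborel (cbox 0 1 :: (real ^ 'n::finite) set) = 1"
  by (subst content_cbox_cart) (simp_all add: interval_ne_empty_cart)

lemma norm_torus_integral_le:
  fixes g :: "real ^ 'n::finite \<Rightarrow> complex"
  assumes "continuous_on (cbox 0 1) g" "\<And>x. cmod (g x) \<le> B"
  shows "cmod (torus_integral g) \<le> B"
proof -
  have "0 \<le> B" using assms(2)[of 0] norm_ge_zero order_trans by blast
  then have "cmod (torus_integral g) \<le> B * measure lborel (cbox 0 1 :: (real ^ 'n::finite) set)"
    unfolding torus_integral_def
    by (rule integrable_bound[OF _ integrable_continuous[OF assms(1)] assms(2)])
  then show ?thesis by (simp add: content_unit_cube)
qed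

lemma fourier_transform_bound:
  assumes "f \<in> test_functions"
  shows "cmod (fourier_transform f k) \<le> sup_norm f"
  unfolding fourier_transform_def
  by (rule norm_torus_integral_le)
     (auto simp: norm_mult intro!: continuous_on_mult test_continuous[OF assms]
        test_continuous[OF character_test] sup_norm_ge[OF assms])

text \<open>Integration by parts: the derivative of the periodic product of \<open>f\<close> with
  \<open>character (- k)\<close> integrates to zero, and differentiating the character produces the
  factor.\<close>

lemma fourier_transform_partial_deriv:
  assumes f: "f \<in> test_functions"
  shows "fourier_transform (partial_deriv i f) k = (2 * of_real pi * \<i> * of_int (k $ i)) * fourier_transform f k"
proof -
  let ?c = "2 * of_real pi * \<i> * of_int (k $ i) :: complex"
  let ?g = "\<lambda>x. f x * character (- k) x"
  let ?g' = "\<lambda>x v. f x * (2 * of_real pi * \<i> * of_real (of_int_vec (- k) \<bullet> v) * character (- k) x)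
     + (\<Sum>j\<in>UNIV. of_real (v $ j) * partial_deriv j f x) * character (- k) x"
  have D: "(?g has_derivative ?g' x) (at x)" for x
    by (rule has_derivative_mult[OF test_has_derivative[OF f] character_has_derivative])
  have E: "?g' x (axis i 1) = partial_deriv i f x * character (- k) x - ?c * (f x * character (- k) x)" for x
    by (simp add: axis_def if_distrib if_distribR sum.delta inner_vec_def of_int_vec_minus cong: if_cong)
  have "integral (cbox 0 1) (\<lambda>x. ?g' x (axis i 1)) = 0"
  proof (rule integral_partial_deriv_periodic[OF D])
    show "continuous_on UNIV (\<lambda>x. ?g' x (axis i 1))"
      unfolding E by (intro continuous_intros test_continuous test_partial_deriv f character_test)
    show "f (x + axis i 1) * character (- k) (x + axis i 1) = f x * character (- k) x" for x
      using test_periodic[OF f, of x "axis i 1"] test_periodic[OF character_test, of "- k" x "axis i 1"]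
      by (simp add: of_int_vec_axis)
  qed
  then show ?thesis
    unfolding E fourier_transform_def torus_integral_def
    by (subst (asm) integral_diff)
       (auto intro!: test_integrable test_partial_deriv f integrable_on_mult_right)
qed

lemma fourier_transform_iter_partial:
  assumes f: "f \<in> test_functions"
  shows "fourier_transform (iter_partial is f) k =
    (\<Prod>i\<leftarrow>is. 2 * of_real pi * \<i> * of_int (k $ i)) * fourier_transform f k"
  by (induction "is")
     (simp_all add: iter_partial_Cons fourier_transform_partial_deriv test_iter_partial f)

lemma fourier_transform_character: "fourier_transform (character k) l = (if k = l then 1 else 0)"
proof (cases "k = l")
  case True
  then show ?thesis
    by (simp add: fourier_transform_def torus_integral_def content_unit_cube flip: character_add)
next
  case False
  then obtain i where i: "k $ i \<noteq> l $ i" by (auto simp: vec_eq_iff)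
  \<comment> \<open>Orthogonality without evaluating an integral: the coefficient at
    \<open>l\<close> of the \<open>i\<close>-th derivative of \<open>character k\<close> is computed
    once from the character and once from the derivative rule, and the two factors differ.\<close>
  have "(2 * of_real pi * \<i> * of_int (k $ i)) * fourier_transform (character k) l =
        (2 * of_real pi * \<i> * of_int (l $ i)) * fourier_transform (character k) l"
    using fourier_transform_partial_deriv[OF character_test, of i k l]
    by (simp only: partial_deriv_character fourier_transform_cmult)
  with i have "fourier_transform (character k) l = 0" by simp
  with False show ?thesis by simp
qed

section \<open>Uniqueness of Fourier coefficients\<close>

text \<open>Only linear operations are generators, so inductions need linearity alone. Closure under
  products is derived from the fact that characters multiply to characters.\<close>

inductive trig_poly :: "(real ^ 'n::finite \<Rightarrow> complex) \<Rightarrow> bool" where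
  character: "trig_poly (\<lambda>x. character k x)"
| add: "trig_poly f \<Longrightarrow> trig_poly g \<Longrightarrow> trig_poly (\<lambda>x. f x + g x)"
| cmult: "trig_poly f \<Longrightarrow> trig_poly (\<lambda>x. c * f x)"

lemma trig_poly_const: "trig_poly (\<lambda>x. c)"
  using trig_poly.cmult[OF trig_poly.character[of 0], of c] by simp

lemma trig_poly_mult_character:
  "trig_poly f \<Longrightarrow> trig_poly (\<lambda>x. f x * character k x)"
proof (induction rule: trig_poly.induct)
  case (character l)
  then show ?case by (simp add: trig_poly.character flip: character_add)
next
  case (add f g)
  then show ?case by (simp add: trig_poly.add distrib_right)
next
  case (cmult f c)
  then show ?case by (simp add: trig_poly.cmult mult.assoc)
qed

lemma trig_poly_mult:
  assumes g: "trig_poly g" and f: "trig_poly f"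
  shows "trig_poly (\<lambda>x. f x * g x)"
  using g
proof (induction rule: trig_poly.induct)
  case (character k)
  then show ?case by (rule trig_poly_mult_character[OF f])
next
  case (add f g)
  then show ?case by (simp add: trig_poly.add distrib_left)
next
  case (cmult f c)
  then show ?case by (simp add: trig_poly.cmult mult.left_commute)
qed

lemma trig_poly_test: "trig_poly f \<Longrightarrow> f \<in> test_functions"
  by (induction rule: trig_poly.induct) (auto intro: test_functions_add test_functions_cmult)

text \<open>This realises the torus as a compact product of circles, on which the Stone-Weierstrass
  theorem can be applied.\<close>

definition torus_map :: "real ^ 'n::finite \<Rightarrow> complex ^ 'n" where
  "torus_map x = (\<chi> i. cis (2 * pi * x $ i))"

lemma continuous_on_torus_map: "continuous_on S torus_map"
  unfolding torus_map_def by (intro continuous_intros)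

lemma character_axis: "character (axis i 1) x = torus_map x $ i"
  by (simp add: character_def torus_map_def cis_conv_exp inner_vec_def axis_def if_distrib if_distribR
    sum.delta mult_ac cong: if_cong)

lemma torus_map_eqD:
  assumes "torus_map x = torus_map y"
  obtains m where "x = y + of_int_vec m"
proof -
  have "\<exists>m::int. x $ i = y $ i + m" for i
  proof -
    have "cis (2 * pi * x $ i) = cis (2 * pi * y $ i)"
      using assms by (simp add: torus_map_def vec_eq_iff)
    then have "exp (\<i> * of_real (2 * pi * x $ i)) = exp (\<i> * of_real (2 * pi * y $ i))"
      by (simp add: cis_conv_exp)
    then obtain m :: int where "\<i> * of_real (2 * pi * x $ i) = \<i> * of_real (2 * pi * y $ i) + of_real (real_of_int (2 * m) * pi) * \<i>"
      unfolding exp_eq by blast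
    then have "Im (\<i> * of_real (2 * pi * x $ i)) = Im (\<i> * of_real (2 * pi * y $ i) + of_real (real_of_int (2 * m) * pi) * \<i>)"
      by simp
    then have "2 * pi * x $ i = 2 * pi * (y $ i + m)" by (simp add: algebra_simps)
    then show ?thesis by auto
  qed
  then obtain m where "\<And>i. x $ i = y $ i + real_of_int (m i)" by metis
  then have "x = y + of_int_vec (\<chi> i. m i)" by (simp add: vec_eq_iff)
  then show ?thesis by (rule that)
qed

text \<open>A periodic function descends to the product of circles. There the real and imaginary
  parts of the coordinates separate points and pull back to trigonometric polynomials.\<close>

lemma trig_poly_dense_real:
  fixes f :: "real ^ 'n::finite \<Rightarrow> real"
  assumes cont: "continuous_on UNIV f"
    and per: "\<And>x m. f (x + of_int_vec m) = f x"
    and e: "e > 0"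
  obtains p where "trig_poly p" "\<And>x. cmod (of_real (f x) - p x) < e"
proof -
  let ?Q = "cbox 0 1 :: (real ^ 'n) set"
  define T where "T = torus_map ` ?Q"
  \<comment> \<open>The members are real-valued, as the approximation theorem demands, while their
    pullbacks may be combinations of characters with complex coefficients.\<close>
  define R where "R = {g :: complex ^ 'n \<Rightarrow> real. continuous_on T g \<and> trig_poly (\<lambda>x. of_real (g (torus_map x)))}"
  have T: "torus_map x \<in> T" for x
  proof -
    obtain m where m: "x + of_int_vec m \<in> ?Q" by (rule box_representative)
    have "torus_map (x + of_int_vec m) = torus_map x"
      by (simp add: vec_eq_iff character_shift character_of_int_vec flip: character_axis)
    with m show ?thesis by (metis T_def imageI)
  qed
  interpret function_ring_on R T
  proof
    show "compact T"
      unfolding T_def by (intro compact_continuous_image continuous_on_torus_map compact_cbox)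
    fix z w assume "z \<in> T" "w \<in> T" "z \<noteq> w"
    then obtain i where i: "z $ i \<noteq> w $ i" by (auto simp: vec_eq_iff)
    have conj_ch: "cnj (character (axis i 1) x) = character (- axis i 1) x" for x :: "real ^ 'n"
      by (simp add: character_def exp_cnj of_int_vec_minus)
    have re: "of_real (Re (torus_map x $ i)) = (1/2) * character (axis i 1) x + (1/2) * character (- axis i 1) x" for x :: "real ^ 'n"
      by (simp add: character_axis[symmetric] conj_ch[symmetric] complex_eq_iff)
    have im: "of_real (Im (torus_map x $ i)) = (- \<i>/2) * character (axis i 1) x + (\<i>/2) * character (- axis i 1) x" for x :: "real ^ 'n"
      by (simp add: character_axis[symmetric] conj_ch[symmetric] complex_eq_iff)
    have 1: "(\<lambda>z. Re (z $ i)) \<in> R"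
      unfolding R_def mem_Collect_eq re by (auto simp del: times_divide_eq_left intro!: continuous_intros trig_poly.intros)
    have 2: "(\<lambda>z. Im (z $ i)) \<in> R"
      unfolding R_def mem_Collect_eq im by (rule conjI) (intro continuous_intros, intro trig_poly.add trig_poly.cmult trig_poly.character)
    show "\<exists>g\<in>R. g z \<noteq> g w"
      using i bexI[OF _ 1, of "\<lambda>g. g z \<noteq> g w"] bexI[OF _ 2, of "\<lambda>g. g z \<noteq> g w"]
      unfolding complex_eq_iff by argo
  next
    fix g1 g2 assume "g1 \<in> R" "g2 \<in> R"
    then show "(\<lambda>x. g1 x * g2 x) \<in> R" "(\<lambda>x. g1 x + g2 x) \<in> R"
      unfolding R_def by (auto intro!: continuous_intros trig_poly_mult trig_poly.add)
  qed (auto simp: R_def trig_poly_const)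
  \<comment> \<open>The function \<open>f\<close> transported to the product of circles; by
    periodicity the chosen preimage does not affect the value.\<close>
  define F where "F z = f (SOME x. torus_map x = z)" for z
  have F: "F (torus_map x) = f x" for x
  proof -
    have "torus_map (SOME y. torus_map y = torus_map x) = torus_map x"
      by (rule someI) (rule refl)
    then obtain m where "(SOME y. torus_map y = torus_map x) = x + of_int_vec m"
      by (rule torus_map_eqD)
    then show ?thesis
      by (simp add: F_def per)
  qed
  have "continuous_on T F"
  \<comment> \<open>The preimage of a closed set under \<open>F\<close> is the
    \<open>torus_map\<close> image of a compact part of the cube, hence closed.\<close>
  proof (rule continuous_on_closed_invariant[THEN iffD2], intro allI impI)
    fix B :: "real set" assume B: "closed B"
    have "compact (?Q \<inter> f -` B)"
      by (intro compact_Int_closed compact_cbox closed_vimage B cont)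
    then have "compact (torus_map ` (?Q \<inter> f -` B))"
      by (intro compact_continuous_image continuous_on_torus_map)
    moreover have "torus_map ` (?Q \<inter> f -` B) \<inter> T = F -` B \<inter> T"
      by (auto simp: T_def F) (metis F)
    ultimately show "\<exists>A. closed A \<and> A \<inter> T = F -` B \<inter> T"
      by (intro exI[of _ "torus_map ` (?Q \<inter> f -` B)"] conjI compact_imp_closed)
  qed
  from Stone_Weierstrass_basic[OF this e] obtain g where
    g: "g \<in> R" "\<And>z. z \<in> T \<Longrightarrow> \<bar>F z - g z\<bar> < e" by blast
  show ?thesis
  proof
    show "trig_poly (\<lambda>x. of_real (g (torus_map x)))" using g R_def by auto
    show "cmod (of_real (f x) - of_real (g (torus_map x))) < e" for x
      using g(2)[OF T, of x] by (simp add: F flip: of_real_diff)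
  qed
qed

lemma trig_poly_dense:
  fixes f :: "real ^ 'n::finite \<Rightarrow> complex"
  assumes cont: "continuous_on UNIV f"
    and per: "\<And>x m. f (x + of_int_vec m) = f x"
    and e: "e > 0"
  obtains p where "trig_poly p" "\<And>x. cmod (f x - p x) < e"
proof -
  obtain p where p: "trig_poly p" "\<And>x. cmod (of_real (Re (f x)) - p x) < e / 2"
    by (rule trig_poly_dense_real[of "\<lambda>x. Re (f x)" "e / 2"]) (use assms in \<open>auto intro!: continuous_intros\<close>)
  obtain q where q: "trig_poly q" "\<And>x. cmod (of_real (Im (f x)) - q x) < e / 2"
    by (rule trig_poly_dense_real[of "\<lambda>x. Im (f x)" "e / 2"]) (use assms in \<open>auto intro!: continuous_intros\<close>)
  show ?thesis
  proof
    show "trig_poly (\<lambda>x. p x + \<i> * q x)" by (rule trig_poly.add[OF p(1) trig_poly.cmult[OF q(1)]])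
    fix x
    have "f x - (p x + \<i> * q x) = (of_real (Re (f x)) - p x) + \<i> * (of_real (Im (f x)) - q x)"
      by (simp add: complex_eq_iff)
    also have "cmod \<dots> \<le> cmod (of_real (Re (f x)) - p x) + cmod (of_real (Im (f x)) - q x)"
      by (rule order_trans[OF norm_triangle_ineq]) (simp add: norm_mult)
    finally show "cmod (f x - (p x + \<i> * q x)) < e"
      using p(2)[of x] q(2)[of x] by linarith
  qed
qed

text \<open>Vanishing coefficients make \<open>f\<close> orthogonal to all trigonometric
  polynomials. Approximating its conjugate uniformly by these shows that the squared modulus has
  integral zero, and continuity concludes. Continuity is the right generality, because the lemma is
  applied to the sum of a Fourier series before that sum is known to be smooth.\<close>

lemma fourier_transform_eq_0_imp:
  fixes f :: "real ^ 'n::finite \<Rightarrow> complex"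
  assumes cont: "continuous_on UNIV f"
    and per: "\<And>x m. f (x + of_int_vec m) = f x"
    and zero: "\<And>k. fourier_transform f k = 0"
  shows "f x = 0"
proof -
  let ?Q = "cbox 0 1 :: (real ^ 'n) set"
  have contQ: "continuous_on ?Q f" using cont continuous_on_subset by blast
  have tp: "torus_integral (\<lambda>x. f x * p x) = 0" if "trig_poly p" for p
    using that
  proof (induction rule: trig_poly.induct)
    case (character k)
    then show ?case using zero[of "- k"] by (simp add: fourier_transform_def)
  next
    case (add p q)
    then have "(\<lambda>x. f x * p x) integrable_on ?Q" "(\<lambda>x. f x * q x) integrable_on ?Q"
      by (simp_all add: integrable_continuous continuous_on_mult contQ test_continuous trig_poly_test)
    with add show ?case by (simp add: torus_integral_def distrib_left integral_add)
  next
    case (cmult p c)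
    then show ?case by (simp add: torus_integral_def mult.left_commute)
  qed
  have "bounded (f ` ?Q)"
    by (intro compact_imp_bounded compact_continuous_image contQ compact_cbox)
  then obtain B where B: "\<And>x. x \<in> ?Q \<Longrightarrow> cmod (f x) \<le> B"
    by (auto simp: bounded_iff)
  have B': "cmod (f x) \<le> B" for x
    by (metis B per box_representative)
  then have B0: "0 \<le> B" using norm_ge_zero order_trans by blast
  have "cmod (torus_integral (\<lambda>x. f x * cnj (f x))) \<le> B * e" if e: "e > 0" for e
  proof -
    obtain p where p: "trig_poly p" "\<And>x. cmod (cnj (f x) - p x) < e"
      by (rule trig_poly_dense[of "\<lambda>x. cnj (f x)" e]) (use e in \<open>auto intro!: continuous_intros cont simp: per\<close>)
    have cp: "continuous_on ?Q p" using p trig_poly_test test_continuous by blast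
    have "torus_integral (\<lambda>x. f x * cnj (f x)) =
        torus_integral (\<lambda>x. f x * (cnj (f x) - p x)) + torus_integral (\<lambda>x. f x * p x)"
      unfolding torus_integral_def
      by (subst integral_add[symmetric])
         (auto intro!: integrable_continuous continuous_intros contQ cp simp: algebra_simps)
    also have "\<dots> = torus_integral (\<lambda>x. f x * (cnj (f x) - p x))"
      by (simp add: tp p)
    also have "cmod \<dots> \<le> B * e"
      by (rule norm_torus_integral_le)
         (auto intro!: continuous_intros contQ cp mult_mono B' B0 less_imp_le[OF p(2)] simp: norm_mult)
    finally show ?thesis .
  qed
  note bound = this
  have "cmod (torus_integral (\<lambda>x. f x * cnj (f x))) \<le> 0 + e" if "e > 0" for e
  proof -
    \<comment> \<open>Dividing by \<open>B + 1\<close> instead of \<open>B\<close> covers the case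
      \<open>B = 0\<close>.\<close>
    have "B * (e / (B + 1)) \<le> e"
      using that B0 by (simp add: field_simps)
    with bound[of "e / (B + 1)"] that B0 show ?thesis by simp
  qed
  then have "torus_integral (\<lambda>x. f x * cnj (f x)) = 0"
    using field_le_epsilon norm_le_zero_iff by blast
  then have "integral ?Q (\<lambda>x. complex_of_real ((cmod (f x))\<^sup>2)) = 0"
    by (simp only: torus_integral_def complex_norm_square)
  then have "((\<lambda>x. complex_of_real ((cmod (f x))\<^sup>2)) has_integral 0) ?Q"
    by (subst has_integral_iff) (auto intro!: integrable_continuous continuous_intros contQ)
  then have i0: "((\<lambda>x. (cmod (f x))\<^sup>2) has_integral 0) ?Q"
    by (drule_tac has_integral_linear[OF _ bounded_linear_Re]) (simp only: o_def Re_complex_of_real zero_complex.sel)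
  have "f x = 0" if "x \<in> ?Q" for x
  proof -
    have "(cmod (f x))\<^sup>2 = 0"
      by (rule has_integral_0_cbox_imp_0[OF _ _ i0 _ that])
         (auto intro!: continuous_intros contQ simp: interval_ne_empty_cart)
    then show ?thesis by simp
  qed
  then show ?thesis by (metis per box_representative)
qed

section \<open>Rapid decay and Fourier inversion\<close>

definition freq_weight :: "int ^ 'n::finite \<Rightarrow> real" where
  "freq_weight k = 1 + norm (of_int_vec k :: real ^ 'n)"

lemma freq_weight_ge_1: "1 \<le> freq_weight k"
  by (simp add: freq_weight_def)

lemma freq_weight_minus [simp]: "freq_weight (- k) = freq_weight k"
  by (simp add: freq_weight_def of_int_vec_minus)

lemma freq_weight_component: "1 + \<bar>real_of_int (k $ i)\<bar> \<le> freq_weight k"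
  using component_le_norm_cart[of "of_int_vec k" i] by (simp add: freq_weight_def)

lemma polynomial_growth_iff: "polynomial_growth a \<longleftrightarrow> (\<exists>C N. \<forall>k. \<bar>a k\<bar> \<le> C * freq_weight k ^ N)"
  by (simp add: polynomial_growth_def freq_weight_def)

lemma summable_on_int_inverse_square: "(\<lambda>m::int. 1 / (1 + \<bar>real_of_int m\<bar>)\<^sup>2) summable_on UNIV"
proof -
  let ?g = "\<lambda>m::int. 1 / (1 + \<bar>real_of_int m\<bar>)\<^sup>2"
  have "summable (\<lambda>n. inverse (real n ^ 2))"
    by (rule inverse_power_summable) simp
  then have "summable (\<lambda>n. inverse (real (Suc n) ^ 2))"
    by (subst summable_Suc_iff)
  then have nat: "(\<lambda>n. 1 / (1 + real n)\<^sup>2) summable_on UNIV"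
    by (subst summable_on_UNIV_nonneg_real_iff) (auto simp: inverse_eq_divide)
  have 1: "?g summable_on range int"
    by (subst summable_on_reindex) (use nat in \<open>auto simp: o_def\<close>)
  have 2: "?g summable_on range (\<lambda>n. - int n)"
    by (subst summable_on_reindex) (use nat in \<open>auto simp: o_def inj_on_def\<close>)
  \<comment> \<open>The common element 0 is removed from the second half to make the union
    disjoint.\<close>
  have "(UNIV :: int set) = range int \<union> (range (\<lambda>n. - int n) - range int)"
    by auto (metis int_cases2 rangeI)
  moreover have "?g summable_on (range int \<union> (range (\<lambda>n. - int n) - range int))"
    by (intro summable_on_Un_disjoint 1 summable_on_subset[OF 2]) auto
  ultimately show ?thesis by simp
qed

text \<open>The weight dominates \<open>1 + \<bar>k $ i\<bar>\<close> for each of the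
  \<open>n\<close> coordinates, so each term is at most a product of \<open>n\<close>
  one-dimensional inverse squares. A sum of such products over a box factors.\<close>

lemma summable_on_freq_weight:
  "(\<lambda>k::int ^ 'n::finite. 1 / freq_weight k ^ (2 * CARD('n))) summable_on UNIV"
proof (rule nonneg_bdd_above_summable_on)
  let ?g = "\<lambda>m::int. 1 / (1 + \<bar>real_of_int m\<bar>)\<^sup>2"
  show "bdd_above (sum (\<lambda>k::int ^ 'n. 1 / freq_weight k ^ (2 * CARD('n))) ` {F. F \<subseteq> UNIV \<and> finite F})"
  proof (rule bdd_aboveI2)
    fix F :: "(int ^ 'n) set" assume "F \<in> {F. F \<subseteq> UNIV \<and> finite F}"
    then have fin: "finite F" by simp
    \<comment> \<open>All coordinates of frequencies in \<open>F\<close>, so that \<open>F\<close>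
      lies in the finite box with side \<open>J\<close>.\<close>
    define J where "J = (\<Union>k\<in>F. range (($) k))"
    have finJ: "finite J" using fin by (auto simp: J_def)
    have le: "1 / freq_weight k ^ (2 * CARD('n)) \<le> (\<Prod>i\<in>UNIV. ?g (k $ i))" for k :: "int ^ 'n"
    proof -
      have "(\<Prod>i\<in>UNIV. (1 + \<bar>real_of_int (k $ i)\<bar>)\<^sup>2) \<le> (\<Prod>i\<in>(UNIV :: 'n set). (freq_weight k)\<^sup>2)"
        by (intro prod_mono conjI power_mono freq_weight_component) auto
      also have "\<dots> = freq_weight k ^ (2 * CARD('n))"
        by (simp add: power_mult)
      finally have "1 / freq_weight k ^ (2 * CARD('n)) \<le> 1 / (\<Prod>i\<in>UNIV. (1 + \<bar>real_of_int (k $ i)\<bar>)\<^sup>2)"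
        by (intro divide_left_mono mult_pos_pos prod_pos) (auto intro!: zero_less_power less_le_trans[OF _ freq_weight_ge_1])
      then show ?thesis by (simp add: prod_dividef)
    qed
    have "sum (\<lambda>k::int ^ 'n. 1 / freq_weight k ^ (2 * CARD('n))) F \<le> (\<Sum>k\<in>F. \<Prod>i\<in>UNIV. ?g (k $ i))"
      by (intro sum_mono le)
    also have "\<dots> = (\<Sum>h\<in>vec_nth ` F. \<Prod>i\<in>UNIV. ?g (h i))"
      by (subst sum.reindex) (auto simp: inj_on_def vec_nth_inject)
    also have "\<dots> \<le> (\<Sum>h\<in>PiE UNIV (\<lambda>_. J). \<Prod>i\<in>(UNIV :: 'n set). ?g (h i))"
      by (intro sum_mono2 finite_PiE prod_nonneg) (use finJ[unfolded J_def] in \<open>auto simp: J_def\<close>)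
    also have "\<dots> = (\<Prod>i\<in>(UNIV :: 'n set). \<Sum>m\<in>J. ?g m)"
      by (rule prod_sum_PiE[symmetric]) (auto simp: finJ)
    also have "\<dots> \<le> (\<Prod>i\<in>(UNIV :: 'n set). infsum ?g UNIV)"
      by (intro prod_mono conjI sum_nonneg finite_sum_le_infsum summable_on_int_inverse_square) (auto simp: finJ)
    finally show "sum (\<lambda>k::int ^ 'n. 1 / freq_weight k ^ (2 * CARD('n))) F \<le> (\<Prod>i\<in>(UNIV :: 'n set). infsum ?g UNIV)" .
  qed
qed (auto intro: order_trans[OF _ freq_weight_ge_1] simp: zero_le_power)

text \<open>Differentiating \<open>M\<close> times in the direction of the largest component of
  \<open>k\<close> multiplies the coefficient by a power comparable to that of the weight, while the
  coefficient of the derivative is bounded by a seminorm.\<close>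

lemma fourier_transform_decay:
  fixes f :: "real ^ 'n::finite \<Rightarrow> complex"
  assumes f: "f \<in> test_functions"
  shows "cmod (fourier_transform f k) * freq_weight k ^ M \<le> (1 + real CARD('n)) ^ M * seminorm M f"
proof (cases "k = 0")
  case True
  have "cmod (fourier_transform f k) \<le> sup_norm (iter_partial [] f)"
    using fourier_transform_bound[OF f] by simp
  also have "\<dots> \<le> seminorm M f" by (rule seminorm_ge[OF f]) simp
  also have "\<dots> \<le> (1 + real CARD('n)) ^ M * seminorm M f"
    using mult_right_mono[OF one_le_power seminorm_nonneg[OF f], of "1 + real CARD('n)" M] by simp
  finally show ?thesis by (simp add: True freq_weight_def)
next
  case False
  have "Max (range (\<lambda>j. \<bar>k $ j\<bar>)) \<in> range (\<lambda>j. \<bar>k $ j\<bar>)"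
    by (rule Max_in) auto
  then obtain i where "Max (range (\<lambda>j. \<bar>k $ j\<bar>)) = \<bar>k $ i\<bar>" by blast
  then have i: "\<bar>k $ j\<bar> \<le> \<bar>k $ i\<bar>" for j
    by (metis Max_ge finite finite_imageI rangeI)
  from False obtain j where "k $ j \<noteq> 0" by (auto simp: vec_eq_iff)
  with i[of j] have "\<bar>k $ i\<bar> \<ge> 1" by linarith
  \<comment> \<open>A nonzero integer has modulus at least 1; this absorbs the summand 1 of the
    weight and explains the constant \<open>1 + real CARD('n)\<close>.\<close>
  then have ge1: "1 \<le> \<bar>real_of_int (k $ i)\<bar>" by linarith
  let ?t = "\<bar>real_of_int (k $ i)\<bar>"
  have "norm (of_int_vec k :: real ^ 'n) \<le> (\<Sum>j\<in>UNIV. \<bar>real_of_int (k $ j)\<bar>)"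
    using norm_le_l1_cart[of "of_int_vec k :: real ^ 'n"] by simp
  also have "\<dots> \<le> (\<Sum>j\<in>(UNIV :: 'n set). ?t)"
    by (intro sum_mono) (metis i of_int_abs of_int_le_iff)
  finally have W: "freq_weight k \<le> (1 + real CARD('n)) * ?t"
    using ge1 by (simp add: freq_weight_def distrib_right)
  have "?t \<le> 2 * pi * ?t"
    using pi_gt3 ge1 by (simp add: mult_le_cancel_right1)
  then have "freq_weight k ^ M \<le> ((1 + real CARD('n)) * (2 * pi * ?t)) ^ M"
    using freq_weight_ge_1[of k] W
    by (intro power_mono) (auto intro: order_trans[OF W] mult_left_mono)
  also have "\<dots> = (1 + real CARD('n)) ^ M * (2 * pi * ?t) ^ M"
    by (rule power_mult_distrib)
  finally have "cmod (fourier_transform f k) * freq_weight k ^ M \<le>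
      cmod (fourier_transform f k) * ((1 + real CARD('n)) ^ M * (2 * pi * ?t) ^ M)"
    by (rule mult_left_mono) simp
  also have "\<dots> = (1 + real CARD('n)) ^ M * cmod (fourier_transform (iter_partial (replicate M i) f) k)"
    by (simp add: fourier_transform_iter_partial[OF f] norm_mult norm_power prod_list_replicate abs_mult)
  also have "\<dots> \<le> (1 + real CARD('n)) ^ M * seminorm M f"
    by (intro mult_left_mono order_trans[OF fourier_transform_bound seminorm_ge] test_iter_partial f) auto
  finally show ?thesis .
qed

text \<open>If \<open>a\<close> grows with exponent \<open>N\<close>, decay of order
  \<open>N + 2 * CARD('n)\<close> leaves a summable inverse power of the weight. Constants
  independent of \<open>f\<close> give absolute convergence and the continuity estimate for a
  distribution at once. The sign in \<open>- k\<close> is that of the pairing with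
  \<open>fourier_coeff\<close>.\<close>

lemma fourier_pairing_bound:
  fixes a :: "int ^ 'n::finite \<Rightarrow> real"
  assumes "polynomial_growth a"
  obtains C M where "\<And>f. f \<in> test_functions \<Longrightarrow>
     (\<lambda>k. cmod (fourier_transform f (- k)) * \<bar>a k\<bar>) summable_on UNIV \<and>
     (\<Sum>\<^sub>\<infinity>k. cmod (fourier_transform f (- k)) * \<bar>a k\<bar>) \<le> C * seminorm M f"
proof -
  obtain C N where C: "\<And>k. \<bar>a k\<bar> \<le> C * freq_weight k ^ N"
    using assms by (auto simp: polynomial_growth_iff)
  let ?n = "CARD('n)"
  let ?M = "N + 2 * ?n"
  let ?S = "\<Sum>\<^sub>\<infinity>k::int ^ 'n. 1 / freq_weight k ^ (2 * ?n)"
  have C0: "0 \<le> C" using C[of 0] by (simp add: freq_weight_def)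
  show ?thesis
  proof
    fix f :: "real ^ 'n \<Rightarrow> complex" assume f: "f \<in> test_functions"
    let ?K = "C * (1 + real ?n) ^ ?M * seminorm ?M f"
    have le: "cmod (fourier_transform f (- k)) * \<bar>a k\<bar> \<le> ?K * (1 / freq_weight k ^ (2 * ?n))" for k
    proof -
      have pos: "0 < freq_weight k" using freq_weight_ge_1[of k] by linarith
      have "cmod (fourier_transform f (- k)) * \<bar>a k\<bar> \<le> cmod (fourier_transform f (- k)) * (C * freq_weight k ^ N)"
        by (intro mult_left_mono C) auto
      also have "\<dots> = C * (cmod (fourier_transform f (- k)) * freq_weight (- k) ^ ?M) / freq_weight k ^ (2 * ?n)"
        using pos by (simp add: power_add)
      also have "\<dots> \<le> C * ((1 + real ?n) ^ ?M * seminorm ?M f) / freq_weight k ^ (2 * ?n)"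
        using pos by (intro divide_right_mono mult_left_mono fourier_transform_decay f C0) auto
      finally show ?thesis by (simp add: mult_ac)
    qed
    have s: "(\<lambda>k::int ^ 'n. ?K * (1 / freq_weight k ^ (2 * ?n))) summable_on UNIV"
      by (intro summable_on_cmult_right summable_on_freq_weight)
    have s': "(\<lambda>k. cmod (fourier_transform f (- k)) * \<bar>a k\<bar>) summable_on UNIV"
      by (rule summable_on_comparison_test[OF s le]) auto
    have "(\<Sum>\<^sub>\<infinity>k. cmod (fourier_transform f (- k)) * \<bar>a k\<bar>) \<le> (\<Sum>\<^sub>\<infinity>k::int ^ 'n. ?K * (1 / freq_weight k ^ (2 * ?n)))"
      by (rule infsum_mono[OF s' s le])
    also have "\<dots> = ?K * ?S"
      by (rule infsum_cmult_right) (rule summable_on_freq_weight)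
    finally have "(\<Sum>\<^sub>\<infinity>k. cmod (fourier_transform f (- k)) * \<bar>a k\<bar>) \<le> (C * (1 + real ?n) ^ ?M * ?S) * seminorm ?M f"
      by (simp add: mult_ac)
    with s' show "(\<lambda>k. cmod (fourier_transform f (- k)) * \<bar>a k\<bar>) summable_on UNIV \<and>
        (\<Sum>\<^sub>\<infinity>k. cmod (fourier_transform f (- k)) * \<bar>a k\<bar>) \<le> (C * (1 + real ?n) ^ ?M * ?S) * seminorm ?M f" ..
  qed
qed

lemma bij_uminus: "bij (uminus :: int ^ 'n \<Rightarrow> int ^ 'n)"
  by (rule bijI') (auto intro: exI[of _ "- y" for y])

lemma abs_summable_fourier_transform:
  assumes "f \<in> test_functions"
  shows "(\<lambda>k. cmod (fourier_transform f k)) summable_on UNIV"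
proof -
  have "polynomial_growth (\<lambda>k::int ^ 'a. 1)"
    unfolding polynomial_growth_def by (intro exI[of _ 1] exI[of _ 0]) simp
  then obtain C M where "\<And>f. f \<in> test_functions \<Longrightarrow>
     (\<lambda>k::int ^ 'a. cmod (fourier_transform f (- k)) * \<bar>1\<bar>) summable_on UNIV \<and>
     (\<Sum>\<^sub>\<infinity>k::int ^ 'a. cmod (fourier_transform f (- k)) * \<bar>1\<bar>) \<le> C * seminorm M f"
    by (rule fourier_pairing_bound) blast
  then have "(\<lambda>k. cmod (fourier_transform f (- k))) summable_on UNIV"
    using assms by simp
  then show ?thesis
    using summable_on_reindex_bij_betw[OF bij_uminus, of "\<lambda>k. cmod (fourier_transform f k)"] by simp
qed

lemma fourier_transform_sum:
  assumes "finite F" "\<And>k. k \<in> F \<Longrightarrow> g k \<in> test_functions"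
  shows "fourier_transform (\<lambda>x. \<Sum>k\<in>F. g k x) l = (\<Sum>k\<in>F. fourier_transform (g k) l)"
  using assms
  by (induction F) (simp_all add: fourier_transform_add test_functions_sum, simp add: fourier_transform_def torus_integral_def)

section \<open>Convergence of the Fourier series of a test function\<close>

definition fourier_partial_sum :: "(real ^ 'n::finite \<Rightarrow> complex) \<Rightarrow> (int ^ 'n) set \<Rightarrow> real ^ 'n \<Rightarrow> complex" where
  "fourier_partial_sum f F x = (\<Sum>k\<in>F. fourier_transform f k * character k x)"

lemma fourier_partial_sum_test: "fourier_partial_sum f F \<in> test_functions"
  unfolding fourier_partial_sum_def
  by (intro test_functions_sum test_functions_cmult character_test)

lemma fourier_transform_partial_sum:
  "finite F \<Longrightarrow> fourier_transform (fourier_partial_sum f F) l = (if l \<in> F then fourier_transform f l else 0)"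
  unfolding fourier_partial_sum_def
  by (subst fourier_transform_sum)
     (auto simp: fourier_transform_cmult fourier_transform_character test_functions_cmult if_distrib sum.delta cong: if_cong)

text \<open>The series converges uniformly to a continuous periodic function with the coefficients
  of \<open>f\<close>, so uniqueness identifies the two.\<close>

lemma fourier_inversion:
  assumes f: "f \<in> test_functions"
  shows "((\<lambda>k. fourier_transform f k * character k x) has_sum f x) UNIV"
proof -
  define g where "g x = (\<Sum>\<^sub>\<infinity>k. fourier_transform f k * character k x)" for x
  have sums: "(\<lambda>k. fourier_transform f k * character k x) summable_on UNIV" for x
    by (rule abs_summable_summable)
       (use abs_summable_fourier_transform[OF f] in \<open>simp add: norm_mult\<close>)
  have unif: "uniform_limit UNIV (fourier_partial_sum f) g (finite_subsets_at_top UNIV)"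
    unfolding fourier_partial_sum_def[abs_def] g_def[abs_def]
    by (rule Weierstrass_m_test_general[OF _ abs_summable_fourier_transform[OF f]]) (simp add: norm_mult)
  have contg: "continuous_on UNIV g"
    by (rule uniform_limit_theorem[OF _ unif])
       (auto intro!: always_eventually test_continuous fourier_partial_sum_test)
  have perg: "g (x + of_int_vec m) = g x" for x m
    by (simp add: g_def character_shift character_of_int_vec)
  have "g x - f x = 0" for x
  proof (rule fourier_transform_eq_0_imp[of "\<lambda>x. g x - f x"])
    show "continuous_on UNIV (\<lambda>x. g x - f x)"
      by (intro continuous_intros contg test_continuous f)
    show "g (x + of_int_vec m) - f (x + of_int_vec m) = g x - f x" for x m
      by (simp add: perg test_periodic[OF f])
    fix l
    have "cmod (fourier_transform (\<lambda>x. g x - f x) l) \<le> 0 + e" if e: "0 < e" for e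
    proof -
      have "\<forall>\<^sub>F F in finite_subsets_at_top UNIV. finite F \<and> l \<in> F \<and> (\<forall>x. dist (fourier_partial_sum f F x) (g x) < e)"
        using uniform_limitD[OF unif e] eventually_finite_subsets_at_top_finite[of UNIV]
          eventually_finite_subsets_at_top_weakI[of UNIV "\<lambda>F. True"]
          eventually_finite_subsets_at_top[of "\<lambda>F. l \<in> F" UNIV]
        by (auto intro!: eventually_conj exI[of _ "{l}"])
      then obtain F where F: "finite F" "l \<in> F" "\<And>x. dist (fourier_partial_sum f F x) (g x) < e"
        using eventually_happens'[OF finite_subsets_at_top_neq_bot] by blast
      let ?S = "fourier_partial_sum f F"
      \<comment> \<open>As soon as \<open>l\<close> belongs to \<open>F\<close>, the partial sum and
        \<open>f\<close> have the same coefficient at \<open>l\<close>; the error is then the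
        uniform distance from the partial sum to \<open>g\<close>.\<close>
      have "fourier_transform (\<lambda>x. ?S x + (- 1) * f x) l = 0"
        by (subst fourier_transform_add)
           (use F in \<open>auto simp: fourier_partial_sum_test fourier_transform_partial_sum f
               fourier_transform_cmult[of "- 1" f, simplified] test_functions_cmult[of f "- 1", simplified]\<close>)
      then have Z: "torus_integral (\<lambda>x. (?S x - f x) * character (- l) x) = 0"
        by (simp add: fourier_transform_def)
      have cont: "continuous_on (cbox 0 1) g" "continuous_on (cbox 0 1) f" "continuous_on (cbox 0 1) ?S"
        "continuous_on (cbox 0 1) (character (- l))"
        by (auto intro!: test_continuous f fourier_partial_sum_test continuous_on_subset[OF contg])
      have "fourier_transform (\<lambda>x. g x - f x) l =
        torus_integral (\<lambda>x. (g x - ?S x) * character (- l) x) + torus_integral (\<lambda>x. (?S x - f x) * character (- l) x)"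
        unfolding fourier_transform_def torus_integral_def
        by (subst integral_add[symmetric])
           ((rule integrable_continuous, intro continuous_intros cont)+, simp add: algebra_simps)
      also have "cmod \<dots> \<le> e"
        unfolding Z add_0_right
        by (rule norm_torus_integral_le)
           (intro continuous_intros cont, use F(3) in \<open>simp add: norm_mult dist_norm norm_minus_commute less_imp_le\<close>)
      finally show ?thesis by simp
    qed
    then show "fourier_transform (\<lambda>x. g x - f x) l = 0"
      using field_le_epsilon norm_le_zero_iff by blast
  qed
  then have "g x = f x" by simp
  with has_sum_infsum[OF sums, of x] show ?thesis by (simp add: g_def)
qed

lemma sup_norm_remainder:
  assumes f: "f \<in> test_functions" and F: "finite F"
  shows "sup_norm (\<lambda>x. f x - fourier_partial_sum f F x) \<le>
    (\<Sum>\<^sub>\<infinity>k. cmod (fourier_transform f k)) - (\<Sum>k\<in>F. cmod (fourier_transform f k))"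
proof (rule sup_norm_le)
  fix x
  have "((\<lambda>k. fourier_transform f k * character k x) has_sum (f x - fourier_partial_sum f F x)) (UNIV - F)"
    unfolding fourier_partial_sum_def
    by (rule has_sum_Diff[OF fourier_inversion[OF f] has_sum_finite[OF F]]) simp
  moreover have "((\<lambda>k. cmod (fourier_transform f k)) has_sum
      ((\<Sum>\<^sub>\<infinity>k. cmod (fourier_transform f k)) - (\<Sum>k\<in>F. cmod (fourier_transform f k)))) (UNIV - F)"
    by (rule has_sum_Diff[OF has_sum_infsum[OF abs_summable_fourier_transform[OF f]] has_sum_finite[OF F]]) simp
  ultimately show "cmod (f x - fourier_partial_sum f F x) \<le>
      (\<Sum>\<^sub>\<infinity>k. cmod (fourier_transform f k)) - (\<Sum>k\<in>F. cmod (fourier_transform f k))"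
    by (intro norm_has_sum_bound[of "\<lambda>k. fourier_transform f k * character k x"])
       (simp_all add: norm_mult)
qed

text \<open>Differentiating a character and taking the coefficient of a derivative produce the same
  factor.\<close>

lemma iter_partial_fourier_partial_sum:
  assumes f: "f \<in> test_functions" and F: "finite F"
  shows "iter_partial is (fourier_partial_sum f F) = fourier_partial_sum (iter_partial is f) F"
proof -
  have sm: "smooth g" if "g \<in> test_functions" for g :: "real ^ 'a \<Rightarrow> complex"
    using that by (simp add: test_functions_def)
  have "iter_partial is (\<lambda>x. \<Sum>k\<in>F. fourier_transform f k * character k x) =
      (\<lambda>x. \<Sum>k\<in>F. fourier_transform (iter_partial is f) k * character k x)"
    using F
  proof induction
    case empty
    show ?case
      using iter_partial_cmult[OF sm[OF character_test], of "is" 0] by simp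
  next
    case (insert l F)
    have "iter_partial is (\<lambda>x. fourier_transform f l * character l x + (\<Sum>k\<in>F. fourier_transform f k * character k x))
      = (\<lambda>x. fourier_transform (iter_partial is f) l * character l x + (\<Sum>k\<in>F. fourier_transform (iter_partial is f) k * character k x))"
      by (subst iter_partial_add)
         (simp_all only: insert.IH iter_partial_cmult[OF sm[OF character_test]]
           sm test_functions_sum test_functions_cmult character_test,
          simp add: iter_partial_character fourier_transform_iter_partial[OF f] mult.assoc mult.left_commute)
    then show ?case using insert.hyps by simp
  qed
  then show ?thesis by (simp add: fourier_partial_sum_def[abs_def])
qed

text \<open>Convergence in the topology of the test functions. Truncation commutes with derivatives,
  so each of the finitely many terms of the seminorm is bounded by the tail of an absolutely
  convergent series.\<close>

lemma seminorm_remainder_tendsto: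
  assumes f: "f \<in> test_functions"
  shows "((\<lambda>F. seminorm N (\<lambda>x. f x - fourier_partial_sum f F x)) \<longlongrightarrow> 0) (finite_subsets_at_top UNIV)"
proof -
  let ?r = "\<lambda>is F. (\<Sum>\<^sub>\<infinity>k. cmod (fourier_transform (iter_partial is f) k)) -
     (\<Sum>k\<in>F. cmod (fourier_transform (iter_partial is f) k))"
  have r: "(?r is \<longlongrightarrow> 0) (finite_subsets_at_top UNIV)" for "is"
  proof -
    have "((\<lambda>k. cmod (fourier_transform (iter_partial is f) k)) has_sum
        (\<Sum>\<^sub>\<infinity>k. cmod (fourier_transform (iter_partial is f) k))) UNIV"
      by (intro has_sum_infsum abs_summable_fourier_transform test_iter_partial f)
    then have "((\<lambda>F. \<Sum>k\<in>F. cmod (fourier_transform (iter_partial is f) k)) \<longlongrightarrow>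
        (\<Sum>\<^sub>\<infinity>k. cmod (fourier_transform (iter_partial is f) k))) (finite_subsets_at_top UNIV)"
      by (simp add: has_sum_def)
    from tendsto_diff[OF tendsto_const[of "\<Sum>\<^sub>\<infinity>k. cmod (fourier_transform (iter_partial is f) k)"] this]
    show ?thesis by simp
  qed
  have lim: "((\<lambda>F. \<Sum>is | length is \<le> N. ?r is F) \<longlongrightarrow> 0) (finite_subsets_at_top UNIV)"
    using tendsto_sum[of "{is. length is \<le> N}" ?r "\<lambda>_. 0"] r by simp
  have diff: "(\<lambda>x. f x - fourier_partial_sum f F x) = (\<lambda>x. f x + (- 1) * fourier_partial_sum f F x)" for F
    by simp
  have sm: "smooth g" if "g \<in> test_functions" for g :: "real ^ 'a \<Rightarrow> complex"
    using that by (simp add: test_functions_def)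
  have it: "iter_partial is (\<lambda>x. f x - fourier_partial_sum f F x) =
      (\<lambda>x. iter_partial is f x - fourier_partial_sum (iter_partial is f) F x)" if "finite F" for F "is"
    unfolding diff
    by (subst iter_partial_add[OF sm[OF f] smooth_cmult[OF sm[OF fourier_partial_sum_test]]])
       (simp add: iter_partial_cmult[OF sm[OF fourier_partial_sum_test], of _ "- 1", simplified]
         iter_partial_fourier_partial_sum[OF f that])
  have le: "seminorm N (\<lambda>x. f x - fourier_partial_sum f F x) \<le> (\<Sum>is | length is \<le> N. ?r is F)" if "finite F" for F
    unfolding seminorm_def it[OF that]
    by (intro sum_mono sup_norm_remainder test_iter_partial f that)
  show ?thesis
  proof (rule tendsto_sandwich[OF _ _ tendsto_const lim])
    show "\<forall>\<^sub>F F in finite_subsets_at_top UNIV. 0 \<le> seminorm N (\<lambda>x. f x - fourier_partial_sum f F x)"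
      unfolding diff
      by (intro always_eventually allI seminorm_nonneg test_functions_add test_functions_cmult f fourier_partial_sum_test)
    show "\<forall>\<^sub>F F in finite_subsets_at_top UNIV. seminorm N (\<lambda>x. f x - fourier_partial_sum f F x) \<le> (\<Sum>is | length is \<le> N. ?r is F)"
      using le by (intro eventually_finite_subsets_at_top_weakI) auto
  qed
qed

section \<open>Fourier series of periodic distributions\<close>

lemma distribution_bound:
  assumes "u \<in> periodic_distributions"
  obtains C N where "0 \<le> C" "\<And>f. f \<in> test_functions \<Longrightarrow> cmod (u f) \<le> C * seminorm N f"
proof -
  from assms obtain C N where "\<And>f. f \<in> test_functions \<Longrightarrow> cmod (u f) \<le> C * seminorm N f"
    unfolding periodic_distributions_def seminorm_def sup_norm_def by blast
  then have "cmod (u f) \<le> \<bar>C\<bar> * seminorm N f" if "f \<in> test_functions" for f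
    using that seminorm_nonneg[OF that, of N] by (meson abs_ge_self mult_right_mono order_trans)
  then show ?thesis by (intro that[of "\<bar>C\<bar>" N]) auto
qed

lemma distribution_add:
  "u \<in> periodic_distributions \<Longrightarrow> f \<in> test_functions \<Longrightarrow> g \<in> test_functions \<Longrightarrow>
    u (\<lambda>x. f x + g x) = u f + u g"
  by (simp add: periodic_distributions_def)

lemma distribution_cmult:
  "u \<in> periodic_distributions \<Longrightarrow> f \<in> test_functions \<Longrightarrow> u (\<lambda>x. c * f x) = c * u f"
  by (simp add: periodic_distributions_def)

lemma distribution_sum:
  assumes u: "u \<in> periodic_distributions" and "finite F" "\<And>k. k \<in> F \<Longrightarrow> g k \<in> test_functions"
  shows "u (\<lambda>x. \<Sum>k\<in>F. g k x) = (\<Sum>k\<in>F. u (g k))"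
  using assms(2,3)
proof induction
  case empty
  show ?case using distribution_cmult[OF u character_test, of 0] by simp
next
  case (insert k F)
  then show ?case by (simp add: distribution_add[OF u] test_functions_sum)
qed

text \<open>Continuity of \<open>u\<close> turns convergence of the partial sums in every seminorm
  into convergence of their values under \<open>u\<close>.\<close>

lemma distribution_fourier_series:
  assumes u: "u \<in> periodic_distributions" and f: "f \<in> test_functions"
  shows "((\<lambda>k. fourier_transform f (- k) * fourier_coeff u k) has_sum u f) UNIV"
proof -
  obtain C N where CN: "0 \<le> C" "\<And>f. f \<in> test_functions \<Longrightarrow> cmod (u f) \<le> C * seminorm N f"
    using distribution_bound[OF u] by blast
  have test: "(\<lambda>x. f x - fourier_partial_sum f F x) \<in> test_functions" for F
    using test_functions_add[OF f test_functions_cmult[OF fourier_partial_sum_test, of "- 1"]] by simp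
  have S: "u (fourier_partial_sum f F) = (\<Sum>k\<in>F. fourier_transform f k * u (character k))" if "finite F" for F
    unfolding fourier_partial_sum_def[abs_def]
    by (simp add: distribution_sum[OF u that] test_functions_cmult distribution_cmult[OF u])
  have split: "u f = u (\<lambda>x. f x - fourier_partial_sum f F x) + u (fourier_partial_sum f F)" for F
    using distribution_add[OF u test fourier_partial_sum_test, of F f F] by simp
  have "((\<lambda>F. u (\<lambda>x. f x - fourier_partial_sum f F x)) \<longlongrightarrow> 0) (finite_subsets_at_top UNIV)"
  proof (rule Lim_null_comparison)
    show "\<forall>\<^sub>F F in finite_subsets_at_top UNIV. cmod (u (\<lambda>x. f x - fourier_partial_sum f F x)) \<le>
        C * seminorm N (\<lambda>x. f x - fourier_partial_sum f F x)"
      by (intro always_eventually allI CN test)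
    show "((\<lambda>F. C * seminorm N (\<lambda>x. f x - fourier_partial_sum f F x)) \<longlongrightarrow> 0) (finite_subsets_at_top UNIV)"
      using tendsto_mult_left[OF seminorm_remainder_tendsto[OF f], of C] by simp
  qed
  from tendsto_diff[OF tendsto_const[of "u f"] this]
  have "((\<lambda>F. u f - u (\<lambda>x. f x - fourier_partial_sum f F x)) \<longlongrightarrow> u f) (finite_subsets_at_top UNIV)"
    by simp
  moreover have "u f - u (\<lambda>x. f x - fourier_partial_sum f F x) = u (fourier_partial_sum f F)" for F
    using split[of F] by simp
  ultimately have "((\<lambda>F. u (fourier_partial_sum f F)) \<longlongrightarrow> u f) (finite_subsets_at_top UNIV)"
    by simp
  then have "((\<lambda>F. \<Sum>k\<in>F. fourier_transform f k * u (character k)) \<longlongrightarrow> u f) (finite_subsets_at_top UNIV)"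
    by (rule Lim_transform_eventually)
       (auto intro!: eventually_finite_subsets_at_top_weakI simp: S)
  then have "((\<lambda>k. fourier_transform f k * u (character k)) has_sum u f) UNIV"
    by (simp add: has_sum_def)
  \<comment> \<open>Replacing \<open>k\<close> by its negative turns \<open>u (character k)\<close>
    into a Fourier coefficient.\<close>
  then show ?thesis
    using has_sum_reindex_bij_betw[OF bij_uminus, of "\<lambda>k. fourier_transform f k * u (character k)"]
    by (simp add: fourier_coeff_eq)
qed

lemma distribution_eqI:
  assumes u: "u \<in> periodic_distributions" and v: "v \<in> periodic_distributions"
    and eq: "\<And>k. fourier_coeff u k = fourier_coeff v k"
  shows "u = v"
proof (rule extensionalityI)
  show "u \<in> extensional test_functions" "v \<in> extensional test_functions"
    using u v by (auto simp: periodic_distributions_def)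
  show "u f = v f" if "f \<in> test_functions" for f
    using distribution_fourier_series[OF u that] distribution_fourier_series[OF v that]
    by (simp add: eq has_sum_unique)
qed

text \<open>Testing the continuity bound on a character: at most \<open>N\<close> derivatives cost
  at most \<open>N\<close> factors of size \<open>2 * pi * freq_weight k\<close>.\<close>

lemma polynomial_growth_fourier_coeff:
  assumes u: "u \<in> periodic_distributions"
  shows "polynomial_growth (\<lambda>k. cmod (fourier_coeff u k))"
proof -
  obtain C N where CN: "0 \<le> C" "\<And>f. f \<in> test_functions \<Longrightarrow> cmod (u f) \<le> C * seminorm N f"
    using distribution_bound[OF u] by blast
  let ?L = "{is :: 'a list. length is \<le> N}"
  have it: "sup_norm (iter_partial is (character k)) \<le> (2 * pi * freq_weight k) ^ N" if "length is \<le> N"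
    for "is" and k :: "int ^ 'a"
  proof (rule sup_norm_le)
    fix x
    \<comment> \<open>Needed to raise the exponent from the length of the list to
      \<open>N\<close>.\<close>
    have ge1: "1 \<le> 2 * pi * freq_weight k"
      using pi_gt3 freq_weight_ge_1[of k] mult_mono[of 1 "2 * pi" 1 "freq_weight k"] by simp
    have "cmod (\<Prod>i\<leftarrow>is. 2 * of_real pi * \<i> * of_int (k $ i)) \<le> (2 * pi * freq_weight k) ^ length is"
    proof (induction "is")
      case (Cons i "is")
      have "\<bar>real_of_int (k $ i)\<bar> \<le> freq_weight k"
        using freq_weight_component[of k i] by simp
      with Cons show ?case
        using freq_weight_ge_1[of k] by (auto simp: norm_mult intro!: mult_mono)
    qed simp
    also have "\<dots> \<le> (2 * pi * freq_weight k) ^ N"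
      by (rule power_increasing[OF that ge1])
    finally show "cmod (iter_partial is (character k) x) \<le> (2 * pi * freq_weight k) ^ N"
      by (simp add: iter_partial_character norm_mult)
  qed
  have "\<bar>cmod (fourier_coeff u k)\<bar> \<le> (C * card ?L * (2 * pi) ^ N) * freq_weight k ^ N" for k
  proof -
    have "cmod (fourier_coeff u k) \<le> C * seminorm N (character (- k))"
      by (simp add: fourier_coeff_eq CN)
    also have "\<dots> \<le> C * (card ?L * (2 * pi * freq_weight (- k)) ^ N)"
      unfolding seminorm_def using it[of _ "- k"] by (intro mult_left_mono sum_bounded_above CN) auto
    finally show ?thesis by (simp add: power_mult_distrib mult_ac)
  qed
  then show ?thesis unfolding polynomial_growth_iff by blast
qed

text \<open>The converse of the growth bound: the functional is defined by the pairing series, whose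
  uniform estimate is the required continuity.\<close>

lemma distribution_with_coefficients:
  fixes c :: "int ^ 'n::finite \<Rightarrow> complex"
  assumes c: "polynomial_growth (\<lambda>k. cmod (c k))"
  obtains u where "u \<in> periodic_distributions" "\<And>k. fourier_coeff u k = c k"
proof -
  obtain C M where CM: "\<And>f. f \<in> test_functions \<Longrightarrow>
     (\<lambda>k. cmod (fourier_transform f (- k)) * \<bar>cmod (c k)\<bar>) summable_on UNIV \<and>
     (\<Sum>\<^sub>\<infinity>k. cmod (fourier_transform f (- k)) * \<bar>cmod (c k)\<bar>) \<le> C * seminorm M f"
    by (rule fourier_pairing_bound[OF c]) blast
  define u where "u = (\<lambda>f\<in>test_functions. \<Sum>\<^sub>\<infinity>k. fourier_transform f (- k) * c k)"
  have abs: "(\<lambda>k. cmod (fourier_transform f (- k) * c k)) summable_on UNIV" if "f \<in> test_functions" for f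
    using CM[OF that] by (simp add: norm_mult)
  note sums = abs_summable_summable[OF abs]
  have "u \<in> periodic_distributions"
    unfolding periodic_distributions_def
  proof (intro CollectI conjI ballI allI)
    show "u \<in> extensional test_functions" by (simp add: u_def)
    show "u (\<lambda>x. f x + g x) = u f + u g" if "f \<in> test_functions" "g \<in> test_functions" for f g
      using that by (simp add: u_def test_functions_add fourier_transform_add distrib_right infsum_add sums)
    show "u (\<lambda>x. a * f x) = a * u f" if "f \<in> test_functions" for a f
      using that by (simp add: u_def test_functions_cmult fourier_transform_cmult mult.assoc infsum_cmult_right sums)
    have "cmod (u f) \<le> C * seminorm M f" if "f \<in> test_functions" for f
      using norm_infsum_bound[OF abs[OF that]] CM[OF that] that by (simp add: u_def norm_mult)
    then show "\<exists>C N. \<forall>f\<in>test_functions.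
        cmod (u f) \<le> C * (\<Sum>is | length is \<le> N. SUP x. cmod (iter_partial is f x))"
      unfolding seminorm_def sup_norm_def by blast
  qed
  moreover have "fourier_coeff u k = c k" for k
  proof -
    have "(\<Sum>\<^sub>\<infinity>l. fourier_transform (character (- k)) (- l) * c l) = (\<Sum>\<^sub>\<infinity>l\<in>{k}. c l)"
      by (rule infsum_cong_neutral) (auto simp: fourier_transform_character)
    then show ?thesis by (simp add: fourier_coeff_eq u_def)
  qed
  ultimately show ?thesis by (rule that)
qed

section \<open>The Radon transform\<close>

definition line_average :: "int ^ 'n::finite \<Rightarrow> (real ^ 'n \<Rightarrow> complex) \<Rightarrow> real ^ 'n \<Rightarrow> complex" where
  "line_average v f x = integral {0..1} (\<lambda>t. f (x + t *\<^sub>R of_int_vec v))"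

lemma test_integrable_line:
  assumes "f \<in> test_functions"
  shows "(\<lambda>t. f (x + t *\<^sub>R y)) integrable_on {a..b}"
  by (intro integrable_continuous_real continuous_on_compose2[OF test_continuous[OF assms, of UNIV]] continuous_intros) auto

text \<open>Differentiation under the integral sign. The form of the conclusion gives both
  differentiability and commutation with partial derivatives.\<close>

lemma line_average_has_derivative:
  assumes f: "f \<in> test_functions"
  shows "\<exists>D. (line_average v f has_derivative D) (at x) \<and>
    (\<forall>i. D (axis i 1) = line_average v (partial_deriv i f) x)"
proof -
  let ?D = "\<lambda>x h. \<Sum>i\<in>UNIV. of_real (h $ i) * partial_deriv i f x"
  \<comment> \<open>The Leibniz rule asks for continuity in the operator norm; in finite dimension
    this is checked on each vector separately.\<close>
  define fx where "fx x t = Blinfun (?D (x + t *\<^sub>R of_int_vec v))" for x t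
  have bl: "bounded_linear (?D x)" for x
    using has_derivative_bounded_linear[OF test_has_derivative[OF f]] .
  have fx: "blinfun_apply (fx x t) = ?D (x + t *\<^sub>R of_int_vec v)" for x t
    unfolding fx_def by (rule bounded_linear_Blinfun_apply[OF bl])
  have cont: "continuous_on S (\<lambda>p. fx (fst p) (snd p))" for S
  proof (rule continuous_on_blinfun_componentwise)
    fix b :: "real ^ 'a"
    show "continuous_on S (\<lambda>p. blinfun_apply (fx (fst p) (snd p)) b)"
      unfolding fx
      by (intro continuous_intros continuous_on_compose2[OF test_continuous[OF test_partial_deriv[OF f], of UNIV]]) auto
  qed
  have contx: "continuous_on S (fx x)" for S x
    using continuous_on_compose2[OF cont[of UNIV], of S "\<lambda>t. (x, t)"]
    by (simp add: continuous_on_Pair)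
  have "((\<lambda>x. integral (cbox 0 1) (\<lambda>t. f (x + t *\<^sub>R of_int_vec v))) has_derivative
      blinfun_apply (integral (cbox 0 1) (fx x))) (at x within UNIV)"
  proof (rule leibniz_rule)
    fix x :: "real ^ 'a" and t :: real
    have "((\<lambda>x. x + t *\<^sub>R of_int_vec v) has_derivative (\<lambda>h. h)) (at x within UNIV)"
      by (auto intro!: derivative_eq_intros)
    from has_derivative_compose[OF this test_has_derivative[OF f]]
    show "((\<lambda>x. f (x + t *\<^sub>R of_int_vec v)) has_derivative blinfun_apply (fx x t)) (at x within UNIV)"
      by (simp add: fx)
    show "(\<lambda>t. f (x + t *\<^sub>R of_int_vec v)) integrable_on cbox 0 1" for x
      using test_integrable_line[OF f] by simp
    show "continuous_on (UNIV \<times> cbox 0 1) (\<lambda>(x, t). fx x t)"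
      using cont by (simp add: case_prod_unfold)
  qed auto
  then have "(line_average v f has_derivative blinfun_apply (integral {0..1} (fx x))) (at x)"
    by (simp add: line_average_def[abs_def])
  moreover have "blinfun_apply (integral {0..1} (fx x)) (axis i 1) = line_average v (partial_deriv i f) x" for i
    by (simp add: blinfun_apply_integral integrable_continuous_real contx fx line_average_def
        axis_def if_distrib if_distribR sum.delta cong: if_cong)
  ultimately show ?thesis by blast
qed

lemma iter_partial_line_average:
  assumes f: "f \<in> test_functions"
  shows "iter_partial is (line_average v f) = line_average v (iter_partial is f)"
proof (induction "is")
  case (Cons i "is")
  have "partial_deriv i (line_average v (iter_partial is f)) x = line_average v (iter_partial (i # is) f) x" for x
    using line_average_has_derivative[OF test_iter_partial[OF f], of v "is" x]
    by (auto simp: partial_deriv_eq iter_partial_Cons)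
  then show ?case by (simp add: iter_partial_Cons Cons fun_eq_iff)
qed simp

lemma line_average_test:
  assumes f: "f \<in> test_functions"
  shows "line_average v f \<in> test_functions"
proof -
  have "iter_partial is (line_average v f) differentiable (at x)" for "is" x
    unfolding iter_partial_line_average[OF f]
    using line_average_has_derivative[OF test_iter_partial[OF f], of v "is" x] by (auto simp: differentiable_def)
  moreover have "line_average v f (x + of_int_vec m) = line_average v f x" for x m
    using test_periodic[OF f, of "x + t *\<^sub>R of_int_vec v" m for t] by (simp add: line_average_def add_ac)
  ultimately show ?thesis by (simp add: test_functions_def smooth_def)
qed

lemma sup_norm_line_average:
  assumes f: "f \<in> test_functions"
  shows "sup_norm (line_average v f) \<le> sup_norm f"
proof (rule sup_norm_le)
  fix x
  have "cmod (integral {0..1} (\<lambda>t. f (x + t *\<^sub>R of_int_vec v))) \<le> sup_norm f * (1 - 0)"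
    by (rule integral_bound)
       (auto intro!: continuous_on_compose2[OF test_continuous[OF f, of UNIV]] continuous_intros sup_norm_ge[OF f])
  then show "cmod (line_average v f x) \<le> sup_norm f" by (simp add: line_average_def)
qed

text \<open>Averages do not increase sup norms and commute with derivatives. This carries the
  continuity of a distribution over to its Radon transform.\<close>

lemma seminorm_line_average:
  "f \<in> test_functions \<Longrightarrow> seminorm N (line_average v f) \<le> seminorm N f"
  unfolding seminorm_def
  by (intro sum_mono) (simp add: iter_partial_line_average sup_norm_line_average test_iter_partial)

lemma line_average_add:
  "f \<in> test_functions \<Longrightarrow> g \<in> test_functions \<Longrightarrow>
    line_average v (\<lambda>x. f x + g x) = (\<lambda>x. line_average v f x + line_average v g x)"
  by (simp add: line_average_def fun_eq_iff integral_add test_integrable_line)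

lemma line_average_cmult: "line_average v (\<lambda>x. c * f x) = (\<lambda>x. c * line_average v f x)"
  by (simp add: line_average_def fun_eq_iff)

text \<open>Along the segment the character oscillates with the integer frequency \<open>k\<close>
  dot \<open>v\<close>; a full period integrates to zero unless that integer is zero.\<close>

lemma line_average_character:
  "line_average v (character k) = (\<lambda>x. of_bool ((\<Sum>i\<in>UNIV. k $ i * v $ i) = 0) * character k x)"
proof
  fix x
  let ?m = "\<Sum>i\<in>UNIV. k $ i * v $ i"
  let ?c = "2 * of_real pi * \<i> * of_int ?m :: complex"
  have ch: "character k (x + t *\<^sub>R of_int_vec v) = character k x * exp (of_real t * ?c)" for t
    unfolding character_shift
    by (simp add: character_def inner_of_int_vec mult_ac del: of_int_sum)
  have "integral {0..1} (\<lambda>t. exp (of_real t * ?c)) = of_bool (?m = 0)"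
  proof (cases "?m = 0")
    case True
    then show ?thesis by (simp del: of_int_sum)
  next
    case False
    then have c: "?c \<noteq> 0" by (simp del: of_int_sum)
    have "((\<lambda>t. exp (of_real t * ?c)) has_integral (exp (of_real 1 * ?c) / ?c - exp (of_real 0 * ?c) / ?c)) {0..1}"
    proof (rule fundamental_theorem_of_calculus)
      fix t :: real
      have "((\<lambda>z. exp (z * ?c) / ?c) has_field_derivative exp (of_real t * ?c)) (at (of_real t))"
        using c by (auto intro!: derivative_eq_intros simp del: of_int_sum)
      then show "((\<lambda>t. exp (of_real t * ?c) / ?c) has_vector_derivative exp (of_real t * ?c)) (at t within {0..1})"
        by (rule has_vector_derivative_real_field)
    qed simp
    moreover have "exp (of_real 1 * ?c) = 1"
      using exp_2pi_int[of ?m] by (simp del: of_int_sum)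
    ultimately show ?thesis using False by (simp add: integral_unique del: of_int_sum)
  qed
  then show "line_average v (character k) x = of_bool (?m = 0) * character k x"
    unfolding line_average_def ch by (simp del: of_int_sum)
qed

section \<open>The Radon transform as an iterated line average\<close>

lemma radon_fun_0: "radon_fun 0 v f = f"
  by (simp add: radon_fun_def set_lebesgue_integral_def PiM_empty lebesgue_integral_count_space_finite fun_eq_iff)

text \<open>Fubini with the last coordinate as the inner variable: its integral is the line average
  of \<open>f\<close> in direction \<open>v d\<close>, evaluated at the point given by the other
  coordinates.\<close>

lemma radon_fun_Suc:
  assumes f: "f \<in> test_functions"
  shows "radon_fun (Suc d) v f = radon_fun d v (line_average (v d) f)"
proof
  fix x
  interpret product_sigma_finite "\<lambda>_::nat. lborel :: real measure" by standard
  let ?M = "\<lambda>d. \<Pi>\<^sub>M i\<in>{..<d}. (lborel :: real measure)"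
  let ?Q = "\<lambda>d. {..<d} \<rightarrow>\<^sub>E {0..1::real}"
  let ?g = "\<lambda>t. f (x + (\<Sum>i<Suc d. t i *\<^sub>R of_int_vec (v i)))"
  have Suc: "{..<Suc d} = insert d {..<d}" by auto
  have "integrable (?M (Suc d)) (\<lambda>t. indicator (?Q (Suc d)) t *\<^sub>R ?g t)"
  proof (rule integrableI_bounded_set_indicator)
    show "?Q (Suc d) \<in> sets (?M (Suc d))" by (intro sets_PiM_I_finite) auto
    show "emeasure (?M (Suc d)) (?Q (Suc d)) < \<infinity>" by (subst emeasure_PiM) auto
    show "AE t in ?M (Suc d). t \<in> ?Q (Suc d) \<longrightarrow> cmod (?g t) \<le> sup_norm f"
      by (simp add: sup_norm_ge[OF f])
    have "f \<in> borel_measurable borel"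
      by (rule borel_measurable_continuous_onI[OF test_continuous[OF f]])
    moreover have "(\<lambda>t. x + (\<Sum>i<Suc d. t i *\<^sub>R of_int_vec (v i))) \<in> borel_measurable (?M (Suc d))"
      by (intro borel_measurable_add borel_measurable_const borel_measurable_sum borel_measurable_scaleR
          measurable_component_singleton[THEN measurable_compose, of _ _ _ "\<lambda>x. x" borel]) auto
    ultimately show "?g \<in> borel_measurable (?M (Suc d))"
      by (rule measurable_compose[rotated])
  qed
  then have "radon_fun (Suc d) v f x = (\<integral>t. (\<integral>s. indicator (?Q (Suc d)) (t(d := s)) *\<^sub>R ?g (t(d := s)) \<partial>lborel) \<partial>?M d)"
    unfolding radon_fun_def set_lebesgue_integral_def Suc
    by (intro product_integral_insert) auto
  also have "\<dots> = (\<integral>t. indicator (?Q d) t *\<^sub>R line_average (v d) f (x + (\<Sum>i<d. t i *\<^sub>R of_int_vec (v i))) \<partial>?M d)"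
  proof (rule Bochner_Integration.integral_cong[OF refl])
    fix t assume t: "t \<in> space (?M d)"
    then have ext: "t \<in> extensional {..<d}" by (auto simp: space_PiM PiE_def)
    have sum: "(\<Sum>i<Suc d. (t(d := s)) i *\<^sub>R of_int_vec (v i)) =
        (\<Sum>i<d. t i *\<^sub>R of_int_vec (v i)) + s *\<^sub>R (of_int_vec (v d) :: real ^ 'a)" for s
      by simp
    \<comment> \<open>The cube is a set of extensional functions, so its indicator factors only by
      means of the extensionality of \<open>t\<close>.\<close>
    have ind: "indicator (?Q (Suc d)) (t(d := s)) = (indicator (?Q d) t * indicator {0..1} s :: real)" for s
      using ext by (auto simp: indicator_def PiE_def Pi_def extensional_def less_Suc_eq)
    let ?z = "x + (\<Sum>i<d. t i *\<^sub>R of_int_vec (v i))"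
    have "set_integrable lborel {0..1} (\<lambda>s. f (?z + s *\<^sub>R of_int_vec (v d)))"
      by (intro borel_integrable_atLeastAtMost' continuous_on_compose2[OF test_continuous[OF f, of UNIV]] continuous_intros) auto
    from set_borel_integral_eq_integral(2)[OF this]
    have "(\<integral>s. indicator {0..1} s *\<^sub>R f (?z + s *\<^sub>R of_int_vec (v d)) \<partial>lborel) = line_average (v d) f ?z"
      by (simp add: set_lebesgue_integral_def line_average_def)
    then show "(\<integral>s. indicator (?Q (Suc d)) (t(d := s)) *\<^sub>R ?g (t(d := s)) \<partial>lborel) =
        indicator (?Q d) t *\<^sub>R line_average (v d) f ?z"
      unfolding ind sum by (simp add: add.assoc flip: scaleR_scaleR)
  qed
  also have "\<dots> = radon_fun d v (line_average (v d) f) x"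
    by (simp add: radon_fun_def set_lebesgue_integral_def)
  finally show "radon_fun (Suc d) v f x = radon_fun d v (line_average (v d) f) x" .
qed

lemma radon_fun_test: "f \<in> test_functions \<Longrightarrow> radon_fun d v f \<in> test_functions"
  by (induction d arbitrary: f) (simp_all add: radon_fun_0 radon_fun_Suc line_average_test)

lemma seminorm_radon_fun: "f \<in> test_functions \<Longrightarrow> seminorm N (radon_fun d v f) \<le> seminorm N f"
proof (induction d arbitrary: f)
  case (Suc d)
  then show ?case
    using Suc.IH[OF line_average_test] seminorm_line_average order_trans by (fastforce simp: radon_fun_Suc)
qed (simp add: radon_fun_0)

lemma radon_fun_add:
  "f \<in> test_functions \<Longrightarrow> g \<in> test_functions \<Longrightarrow>
    radon_fun d v (\<lambda>x. f x + g x) = (\<lambda>x. radon_fun d v f x + radon_fun d v g x)"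
  by (induction d arbitrary: f g)
     (simp_all add: radon_fun_0 radon_fun_Suc line_average_test line_average_add test_functions_add)

lemma radon_fun_cmult:
  "f \<in> test_functions \<Longrightarrow> radon_fun d v (\<lambda>x. c * f x) = (\<lambda>x. c * radon_fun d v f x)"
  by (induction d arbitrary: f)
     (simp_all add: radon_fun_0 radon_fun_Suc line_average_test line_average_cmult test_functions_cmult)

lemma radon_fun_character:
  "radon_fun d v (character k) =
    (\<lambda>x. of_bool (\<forall>j<d. (\<Sum>i\<in>UNIV. k $ i * v j $ i) = 0) * character k x)"
  by (induction d)
     (auto simp: radon_fun_0 radon_fun_Suc line_average_character radon_fun_cmult fun_eq_iff less_Suc_eq)

lemma radon_distribution:
  assumes u: "u \<in> periodic_distributions"
  shows "radon d A u \<in> periodic_distributions"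
proof -
  let ?R = "radon_fun d (SOME v. integer_basis d v A)"
  obtain C N where CN: "0 \<le> C" "\<And>f. f \<in> test_functions \<Longrightarrow> cmod (u f) \<le> C * seminorm N f"
    using distribution_bound[OF u] by blast
  have R: "radon d A u f = u (?R f)" if "f \<in> test_functions" for f
    using that by (simp add: radon_def)
  \<comment> \<open>The bound for \<open>u\<close> survives with the same \<open>C\<close> and
    \<open>N\<close>, whichever integer vectors the choice operator returns.\<close>
  have "cmod (radon d A u f) \<le> C * seminorm N f" if "f \<in> test_functions" for f
    using CN(2)[OF radon_fun_test[OF that]] mult_left_mono[OF seminorm_radon_fun[OF that] CN(1)]
    unfolding R[OF that] by (rule order_trans)
  then have "\<exists>C N. \<forall>f\<in>test_functions.
        cmod (radon d A u f) \<le> C * (\<Sum>is | length is \<le> N. SUP x. cmod (iter_partial is f x))"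
    unfolding seminorm_def sup_norm_def by blast
  moreover have "radon d A u \<in> extensional test_functions" by (simp add: radon_def)
  ultimately show ?thesis
    unfolding periodic_distributions_def
    by (simp add: R test_functions_add test_functions_cmult radon_fun_add radon_fun_cmult radon_fun_test
        distribution_add[OF u] distribution_cmult[OF u])
qed

section \<open>Rational subspaces\<close>

text \<open>The multiplier is the product of the denominators of all entries.\<close>

lemma clear_denominators:
  fixes b :: "rat ^ 'n::finite"
  obtains N m where "N \<noteq> 0" "of_int_vec m = N *s b"
proof -
  define q where "q i = snd (quotient_of (b $ i))" for i
  have q: "q i > 0" for i by (simp add: q_def quotient_of_denom_pos')
  have b: "b $ i * of_int (q i) = of_int (fst (quotient_of (b $ i)))" for i
    using quotient_of_div[of "b $ i" "fst (quotient_of (b $ i))" "q i"] q[of i]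
    by (simp add: q_def field_simps)
  have "of_int (\<Prod>j\<in>UNIV. q j) * b $ i = of_int ((\<Prod>j\<in>UNIV - {i}. q j) * fst (quotient_of (b $ i)))" for i
  proof -
    have "(\<Prod>j\<in>UNIV. q j) = q i * (\<Prod>j\<in>UNIV - {i}. q j)"
      by (rule prod.remove) auto
    then show ?thesis by (simp only: of_int_mult flip: b) (simp only: mult_ac)
  qed
  then have "of_int_vec (\<chi> i. (\<Prod>j\<in>UNIV - {i}. q j) * fst (quotient_of (b $ i))) = of_int (\<Prod>j\<in>UNIV. q j) *s b"
    by (simp add: vec_eq_iff)
  moreover have "(\<Prod>j\<in>UNIV. q j) > 0"
    using q by (intro prod_pos) simp
  then have "(of_int (\<Prod>j\<in>UNIV. q j) :: rat) \<noteq> 0"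
    unfolding of_int_eq_0_iff by linarith
  ultimately show ?thesis by (intro that)
qed

text \<open>Each vector of a rational basis is rescaled to an integer vector, which preserves the
  span. Spanning a space of dimension \<open>d\<close> with \<open>d\<close> vectors forces them to
  be distinct and independent.\<close>

lemma integer_basis_exists:
  fixes A :: "(rat ^ 'n::finite) set"
  assumes "A \<in> Gr d"
  shows "\<exists>v. integer_basis d v A"
proof -
  have A: "vec.subspace A" "vec.dim A = d" using assms by (auto simp: Gr_def)
  obtain B where B: "B \<subseteq> A" "vec.independent B" "A \<subseteq> vec.span B" "card B = d"
    using vec.basis_exists[of A] A(2) by metis
  have "finite B" using B(2) by (rule vec.finiteI_independent)
  then obtain h where h: "bij_betw h {..<d} B"
    using ex_bij_betw_nat_finite B(4) lessThan_atLeast0 by metis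
  have "\<exists>N m. N \<noteq> 0 \<and> of_int_vec m = N *s h i" for i
    using clear_denominators[of "h i"] by metis
  then obtain N v where N: "\<And>i. N i \<noteq> 0" and v: "\<And>i. of_int_vec (v i) = N i *s h i"
    by metis
  let ?V = "(\<lambda>i. of_int_vec (v i)) ` {..<d} :: (rat ^ 'n) set"
  have sub: "?V \<subseteq> A"
    using h B(1) A(1) by (auto simp: v bij_betw_def intro: vec.subspace_scale)
  have "B \<subseteq> vec.span ?V"
  proof
    fix b assume "b \<in> B"
    then obtain i where i: "i < d" "b = h i" using h by (auto simp: bij_betw_def)
    then have "inverse (N i) *s of_int_vec (v i) \<in> vec.span ?V"
      by (intro vec.span_scale vec.span_base) auto
    then show "b \<in> vec.span ?V" using N by (simp add: v i)
  qed
  then have sup: "A \<subseteq> vec.span ?V"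
    using B(3) vec.span_minimal vec.subspace_span by blast
  have le: "card ?V \<le> d"
    using card_image_le[of "{..<d}"] by simp
  have "vec.dim A \<le> card ?V"
    by (rule vec.dim_le_card[OF sup]) simp
  with le A(2) have "card ?V = d" by simp
  then have "inj_on (\<lambda>i. of_int_vec (v i) :: rat ^ 'n) {..<d}"
    by (intro eq_card_imp_inj_on) auto
  then have "inj_on v {..<d}"
    by (auto simp: inj_on_def)
  moreover have "vec.independent ?V"
    by (rule vec.card_le_dim_spanning[OF sub sup]) (use le A(2) in auto)
  moreover have "vec.span ?V = A"
    using sub sup A(1) by (simp add: subset_antisym vec.span_minimal)
  ultimately show ?thesis unfolding integer_basis_def by blast
qed

section \<open>Orthogonality of frequencies to rational subspaces\<close>

lemma subspace_hyperplane: "vec.subspace {x :: rat ^ 'n::finite. (\<Sum>i\<in>UNIV. of_int (k $ i) * x $ i) = 0}"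
  by (auto simp: vec.subspace_def distrib_left sum.distrib mult.left_commute simp flip: sum_distrib_left)

text \<open>The rational vectors orthogonal to \<open>k\<close> form a subspace, so it contains
  \<open>A\<close> exactly when it contains the generators.\<close>

lemma perp_iff_basis:
  assumes "integer_basis d v A"
  shows "perp k A \<longleftrightarrow> (\<forall>j<d. (\<Sum>i\<in>UNIV. k $ i * v j $ i) = 0)"
proof -
  let ?V = "(\<lambda>i. of_int_vec (v i)) ` {..<d} :: (rat ^ 'a) set"
  let ?K = "{x :: rat ^ 'a. (\<Sum>i\<in>UNIV. of_int (k $ i) * x $ i) = 0}"
  have A: "A = vec.span ?V" using assms by (simp add: integer_basis_def)
  have "perp k A \<longleftrightarrow> A \<subseteq> ?K" by (auto simp: perp_def)
  also have "\<dots> \<longleftrightarrow> ?V \<subseteq> ?K"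
    unfolding A
    using vec.span_minimal[OF _ subspace_hyperplane, of ?V k] vec.span_superset[of ?V] by (meson order_trans)
  also have "\<dots> \<longleftrightarrow> (\<forall>j<d. (of_int (\<Sum>i\<in>UNIV. k $ i * v j $ i) :: rat) = 0)"
    by auto
  also have "\<dots> \<longleftrightarrow> (\<forall>j<d. (\<Sum>i\<in>UNIV. k $ i * v j $ i) = 0)"
    by (simp only: of_int_eq_0_iff)
  finally show ?thesis .
qed

text \<open>Every such subspace lies in the rational hyperplane orthogonal to \<open>k\<close> and
  has at least its dimension, hence equals it.\<close>

lemma hyperplane_unique:
  fixes A B :: "(rat ^ 'n::finite) set"
  assumes "k \<noteq> 0" and A: "A \<in> \<Omega> (CARD('n) - 1) k" and B: "B \<in> \<Omega> (CARD('n) - 1) k"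
  shows "A = B"
proof -
  let ?K = "{x :: rat ^ 'n. (\<Sum>i\<in>UNIV. of_int (k $ i) * x $ i) = 0}"
  obtain i where i: "k $ i \<noteq> 0" using assms(1) by (auto simp: vec_eq_iff)
  have "axis i 1 \<notin> ?K"
    using i by (simp add: axis_def if_distrib sum.delta cong: if_cong)
  then have "?K \<noteq> UNIV" by blast
  moreover have "?K = UNIV" if "vec.dim ?K = CARD('n)"
    by (rule vec.subspace_dim_equal[OF subspace_hyperplane vec.subspace_UNIV subset_UNIV])
       (simp only: that vec_dim_card order_refl)
  ultimately have "vec.dim ?K \<noteq> CARD('n)" by blast
  moreover have "vec.dim ?K \<le> CARD('n)"
    using vec.dim_subset[OF subset_UNIV, of ?K] by (simp only: vec_dim_card)
  ultimately have K: "vec.dim ?K \<le> CARD('n) - 1" by linarith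
  have "C = ?K" if "C \<in> \<Omega> (CARD('n) - 1) k" for C
    by (rule vec.subspace_dim_equal) (use that K subspace_hyperplane[of k] in \<open>auto simp: \<Omega>_def Gr_def perp_def\<close>)
  with A B show ?thesis by blast
qed

lemma fourier_coeff_radon:
  assumes u: "u \<in> periodic_distributions" and A: "A \<in> Gr d"
  shows "fourier_coeff (radon d A u) k = of_bool (perp k A) * fourier_coeff u k"
proof -
  let ?v = "SOME v. integer_basis d v A"
  have v: "integer_basis d ?v A"
    using integer_basis_exists[OF A] by (rule someI_ex)
  \<comment> \<open>The coefficient tests against \<open>character (- k)\<close>; orthogonality is
    insensitive to the sign.\<close>
  have "(\<Sum>i\<in>UNIV. (- k) $ i * ?v j $ i) = - (\<Sum>i\<in>UNIV. k $ i * ?v j $ i)" for j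
    by (simp add: sum_negf)
  then show ?thesis
    by (simp add: fourier_coeff_eq radon_def radon_fun_character distribution_cmult[OF u] perp_iff_basis[OF v])
qed

section \<open>Reconstruction from Radon transforms\<close>

lemma is_fourier_multiplier_unique:
  assumes "is_fourier_multiplier \<omega> u U" "is_fourier_multiplier \<omega> u V"
  shows "U = V"
  using assms by (auto simp: is_fourier_multiplier_def intro: distribution_eqI)

lemma is_fourier_multiplier_fourier_multiplier:
  assumes "polynomial_growth (\<lambda>k. cmod (of_real (\<omega> k) * fourier_coeff u k))"
  shows "is_fourier_multiplier \<omega> u (fourier_multiplier \<omega> u)"
proof -
  obtain U where "U \<in> periodic_distributions" "\<And>k. fourier_coeff U k = of_real (\<omega> k) * fourier_coeff u k"
    using distribution_with_coefficients[OF assms] by blast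
  then have "is_fourier_multiplier \<omega> u U" by (simp add: is_fourier_multiplier_def)
  then show ?thesis
    unfolding fourier_multiplier_def
    by (rule theI[where P = "is_fourier_multiplier \<omega> u"]) (rule is_fourier_multiplier_unique[OF _ \<open>is_fourier_multiplier \<omega> u U\<close>])
qed

lemma polynomial_growth_mono:
  assumes "polynomial_growth b" "\<And>k. \<bar>a k\<bar> \<le> \<bar>b k\<bar>"
  shows "polynomial_growth a"
  using assms unfolding polynomial_growth_def by (meson order_trans)

text \<open>One value is absorbed into the constant, because the weight is at least 1. In
  codimension one this allows an arbitrary total weight at frequency 0.\<close>

lemma polynomial_growth_change_at_0:
  assumes "polynomial_growth b" "\<And>k. k \<noteq> 0 \<Longrightarrow> a k = b k"
  shows "polynomial_growth a"
proof -
  obtain C N where C: "\<And>k. \<bar>b k\<bar> \<le> C * freq_weight k ^ N"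
    using assms(1) by (auto simp: polynomial_growth_iff)
  have C0: "0 \<le> C" using C[of 0] by (simp add: freq_weight_def)
  have "\<bar>a k\<bar> \<le> (C + \<bar>a 0\<bar>) * freq_weight k ^ N" for k
  proof (cases "k = 0")
    case True
    then show ?thesis using C0 by (simp add: freq_weight_def)
  next
    case False
    have "0 \<le> freq_weight k ^ N" using freq_weight_ge_1[of k] by (intro zero_le_power) linarith
    then have "C * freq_weight k ^ N \<le> (C + \<bar>a 0\<bar>) * freq_weight k ^ N"
      by (intro mult_right_mono) auto
    with C[of k] False assms(2) show ?thesis by simp
  qed
  then show ?thesis unfolding polynomial_growth_iff by blast
qed

lemma has_sum_codimension_one:
  fixes g :: "(rat ^ 'n::finite) set \<Rightarrow> 'b::{comm_monoid_add, t2_space}"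
  assumes "k \<noteq> 0" "A \<in> \<Omega> (CARD('n) - 1) k"
  shows "(g has_sum g A) (\<Omega> (CARD('n) - 1) k)"
proof -
  have "\<Omega> (CARD('n) - 1) k = {A}" using hyperplane_unique[OF assms(1) _ assms(2)] assms(2) by blast
  then show ?thesis using has_sum_finite[of "{A}" g] by simp
qed

text \<open>
  The growth hypothesis makes the double series over frequencies and subspaces absolutely
  convergent, so that the order of summation may be exchanged.
\<close>
lemma has_sum_over_subspaces:
  fixes f :: "(real ^ 'n::finite \<Rightarrow> complex) \<Rightarrow> complex"
  assumes f: "f \<in> periodic_distributions" and h: "h \<in> test_functions"
    and abs: "\<And>k. (\<lambda>A. \<bar>w k A\<bar>) summable_on \<Omega> d k"
    and sum: "\<And>k. fourier_coeff f k \<noteq> 0 \<Longrightarrow> (\<Sum>\<^sub>\<infinity>A\<in>\<Omega> d k. w k A) = 1"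
    and growth: "polynomial_growth (\<lambda>k. cmod (fourier_coeff f k) * (\<Sum>\<^sub>\<infinity>A\<in>\<Omega> d k. \<bar>w k A\<bar>))"
    and U: "\<And>A. A \<in> Gr d \<Longrightarrow> U A \<in> periodic_distributions"
    and U_coeff: "\<And>A k. A \<in> Gr d \<Longrightarrow>
      fourier_coeff (U A) k = of_bool (perp k A) * of_real (w k A) * fourier_coeff f k"
  shows "((\<lambda>A. U A h) has_sum f h) (Gr d)"
proof -
  \<comment> \<open>Summing over \<open>k\<close> gives \<open>U A h\<close>, and summing over
    \<open>A\<close> gives the \<open>k\<close>-th term of the series for \<open>f h\<close>. The
    claim is that the two iterated sums agree.\<close>
  define F where "F = (\<lambda>(k, A). fourier_transform h (- k) * fourier_coeff (U A) k)"
  let ?W = "\<lambda>k. \<Sum>\<^sub>\<infinity>A\<in>\<Omega> d k. \<bar>w k A\<bar>"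
  have F: "F (k, A) = of_bool (perp k A) * (fourier_transform h (- k) * fourier_coeff f k * of_real (w k A))"
    if "A \<in> Gr d" for k A
    using that by (simp add: F_def U_coeff mult_ac)
  have W: "0 \<le> ?W k" for k by (intro infsum_nonneg) auto
  have wsum: "w k summable_on \<Omega> d k" for k
    by (rule abs_summable_summable) (use abs[of k] in simp)
  have norm_sum: "((\<lambda>A. norm (F (k, A))) has_sum
      cmod (fourier_transform h (- k)) * \<bar>cmod (fourier_coeff f k) * ?W k\<bar>) (Gr d)" for k
  proof -
    have "((\<lambda>A. cmod (fourier_transform h (- k) * fourier_coeff f k) * \<bar>w k A\<bar>) has_sum
        cmod (fourier_transform h (- k) * fourier_coeff f k) * ?W k) (\<Omega> d k)"
      by (intro has_sum_cmult_right has_sum_infsum abs)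
    \<comment> \<open>Subspaces in \<open>Gr d\<close> outside \<open>\<Omega> d k\<close>
      contribute zero.\<close>
    also have "?this \<longleftrightarrow> ((\<lambda>A. norm (F (k, A))) has_sum
        cmod (fourier_transform h (- k) * fourier_coeff f k) * ?W k) (Gr d)"
      by (rule has_sum_cong_neutral) (auto simp: F \<Omega>_def norm_mult)
    finally show ?thesis using W[of k] by (simp add: norm_mult abs_mult mult.assoc)
  qed
  have F_sum: "((\<lambda>A. F (k, A)) has_sum fourier_transform h (- k) * fourier_coeff f k) (Gr d)" for k
  proof -
    have "((\<lambda>A. fourier_transform h (- k) * fourier_coeff f k * of_real (w k A)) has_sum
        fourier_transform h (- k) * fourier_coeff f k * of_real (\<Sum>\<^sub>\<infinity>A\<in>\<Omega> d k. w k A)) (\<Omega> d k)"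
      by (intro has_sum_cmult_right has_sum_of_real has_sum_infsum wsum)
    also have "?this \<longleftrightarrow> ((\<lambda>A. F (k, A)) has_sum
        fourier_transform h (- k) * fourier_coeff f k * of_real (\<Sum>\<^sub>\<infinity>A\<in>\<Omega> d k. w k A)) (Gr d)"
      by (rule has_sum_cong_neutral) (auto simp: F \<Omega>_def)
    also have "fourier_transform h (- k) * fourier_coeff f k * of_real (\<Sum>\<^sub>\<infinity>A\<in>\<Omega> d k. w k A) =
        fourier_transform h (- k) * fourier_coeff f k"
      \<comment> \<open>Where the coefficient of \<open>f\<close> vanishes both sides are zero;
        elsewhere the weights sum to 1.\<close>
      using sum[of k] by (cases "fourier_coeff f k = 0") auto
    finally show ?thesis .
  qed
  have "(\<lambda>k. cmod (fourier_transform h (- k)) * \<bar>cmod (fourier_coeff f k) * ?W k\<bar>) summable_on UNIV"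
    by (rule fourier_pairing_bound[OF growth]) (use h in blast)
  then have "(\<lambda>x. norm (F x)) summable_on UNIV \<times> Gr d"
    by (rule summable_on_SigmaI[OF norm_sum]) simp
  then have "F summable_on UNIV \<times> Gr d"
    by (rule abs_summable_summable)
  then have "(F has_sum f h) (UNIV \<times> Gr d)"
    by (rule has_sum_SigmaI[OF F_sum distribution_fourier_series[OF f h]])
  then have swapped: "((\<lambda>(A, k). F (k, A)) has_sum f h) (Gr d \<times> UNIV)"
    by (subst (asm) has_sum_swap)
  show ?thesis
  proof (rule has_sum_SigmaD[OF swapped])
    fix A :: "(rat ^ 'n) set" assume "A \<in> Gr d"
    from distribution_fourier_series[OF U[OF this] h]
    show "((\<lambda>k. case (A, k) of (A, k) \<Rightarrow> F (k, A)) has_sum U A h) UNIV"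
      by (simp only: F_def case_prod_conv)
  qed
qed

text \<open>The first conjunct certifies that the descriptions \<open>fourier_multiplier\<close>
  denote actual distributions. Convergence in the sense of \<open>has_sum\<close> is unconditional,
  as suits an index set without a preferred order.\<close>

theorem theorem1p3:
  fixes f :: "(real ^ 'n::finite \<Rightarrow> complex) \<Rightarrow> complex"
    and w :: "int ^ 'n \<Rightarrow> (rat ^ 'n) set \<Rightarrow> real"
    and d :: nat
  assumes n: "2 \<le> CARD('n)"
    and d: "1 \<le> d" "d \<le> CARD('n) - 1"
    and f: "f \<in> periodic_distributions"
    and w_abs: "\<And>k. (\<lambda>A. \<bar>w k A\<bar>) summable_on \<Omega> d k"
    and w_sum: "\<And>k. (\<Sum>\<^sub>\<infinity>A\<in>\<Omega> d k. w k A) = 1"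
    and w_adm: "admissible_weight d w f"
  shows "(\<forall>A\<in>Gr d. is_fourier_multiplier (\<lambda>k. w k A) (radon d A f)
                     (fourier_multiplier (\<lambda>k. w k A) (radon d A f))) \<and>
         (\<forall>h\<in>test_functions.
            ((\<lambda>A. fourier_multiplier (\<lambda>k. w k A) (radon d A f) h) has_sum f h) (Gr d)) \<and>
         (fourier_coeff f 0 = 0 \<and> d = CARD('n) - 1 \<longrightarrow>
            (\<forall>h\<in>test_functions. ((\<lambda>A. radon d A f h) has_sum f h) (Gr d)))"
proof -
  note f_growth = polynomial_growth_fourier_coeff[OF f]
  let ?B = "\<lambda>k. cmod (fourier_coeff f k) * (\<Sum>\<^sub>\<infinity>A\<in>\<Omega> d k. \<bar>w k A\<bar>)"
  let ?U = "\<lambda>A. fourier_multiplier (\<lambda>k. w k A) (radon d A f)"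
  \<comment> \<open>An empty sum would be 0 instead of 1.\<close>
  have nonempty: "\<exists>A. A \<in> \<Omega> d k" for k :: "int ^ 'n"
    using w_sum[of k] by (cases "\<Omega> d k = {}") auto
  have growth: "polynomial_growth ?B"
    \<comment> \<open>Codimension one and nonnegativity both reduce to the growth of the
      coefficients of \<open>f\<close>; the third alternative is the claim itself.\<close>
    using w_adm unfolding admissible_weight_def
  proof (elim disjE)
    assume d1: "d = CARD('n) - 1"
    show ?thesis
    proof (rule polynomial_growth_change_at_0[OF f_growth])
      fix k :: "int ^ 'n" assume k: "k \<noteq> 0"
      obtain A where A: "A \<in> \<Omega> (CARD('n) - 1) k" using nonempty[of k] d1 by blast
      have "w k A = 1"
        using w_sum[of k] infsumI[OF has_sum_codimension_one[OF k A, of "w k"]] by (simp add: d1)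
      then show "?B k = cmod (fourier_coeff f k)"
        using infsumI[OF has_sum_codimension_one[OF k A, of "\<lambda>A. \<bar>w k A\<bar>"]] by (simp add: d1)
    qed
  next
    assume "\<forall>k. \<forall>A\<in>\<Omega> d k. 0 \<le> w k A"
    then have "(\<Sum>\<^sub>\<infinity>A\<in>\<Omega> d k. \<bar>w k A\<bar>) = (\<Sum>\<^sub>\<infinity>A\<in>\<Omega> d k. w k A)" for k
      by (intro infsum_cong) auto
    then show ?thesis using f_growth by (simp add: w_sum)
  qed
  have mult: "is_fourier_multiplier (\<lambda>k. w k A) (radon d A f) (?U A)" if A: "A \<in> Gr d" for A
  proof (rule is_fourier_multiplier_fourier_multiplier, rule polynomial_growth_mono[OF growth])
    fix k :: "int ^ 'n"
    show "\<bar>cmod (of_real (w k A) * fourier_coeff (radon d A f) k)\<bar> \<le> \<bar>?B k\<bar>"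
    proof (cases "perp k A")
      case True
      with A have "A \<in> \<Omega> d k" by (simp add: \<Omega>_def)
      \<comment> \<open>A single weight is bounded by the total absolute weight, so one growth bound
        serves all subspaces.\<close>
      then have "\<bar>w k A\<bar> \<le> (\<Sum>\<^sub>\<infinity>A\<in>\<Omega> d k. \<bar>w k A\<bar>)"
        using finite_sum_le_infsum[OF w_abs[of k], of "{A}"] by simp
      then have "cmod (fourier_coeff f k) * \<bar>w k A\<bar> \<le> ?B k"
        by (intro mult_left_mono) auto
      also have "\<dots> \<le> \<bar>?B k\<bar>" by simp
      finally show ?thesis
        by (simp add: fourier_coeff_radon[OF f A] norm_mult True mult.commute[of "\<bar>w k A\<bar>"])
    qed (simp add: fourier_coeff_radon[OF f A])
  qed
  have series: "((\<lambda>A. ?U A h) has_sum f h) (Gr d)" if h: "h \<in> test_functions" for h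
    by (rule has_sum_over_subspaces[OF f h w_abs w_sum growth])
       (use mult in \<open>auto simp: is_fourier_multiplier_def fourier_coeff_radon[OF f]\<close>)
  have radon_series: "((\<lambda>A. radon d A f h) has_sum f h) (Gr d)"
    if f0: "fourier_coeff f 0 = 0" and d1: "d = CARD('n) - 1" and h: "h \<in> test_functions" for h
  proof (rule has_sum_over_subspaces[OF f h])
    \<comment> \<open>Weight 1 except at frequency 0, where \<open>\<Omega> d 0\<close> is the whole
      infinite \<open>Gr d\<close> and constant weight 1 would not be summable. Since
      \<open>f\<close> has no coefficient there, weight 0 does no harm.\<close>
    let ?w = "\<lambda>(k :: int ^ 'n) (A :: (rat ^ 'n) set). of_bool (k \<noteq> 0) :: real"
    have one: "((\<lambda>A. ?w k A) has_sum 1) (\<Omega> d k)" if k: "k \<noteq> 0" for k :: "int ^ 'n"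
      using nonempty[of k] has_sum_codimension_one[OF k, of _ "?w k"] k by (auto simp: d1)
    show "(\<lambda>A. \<bar>?w k A\<bar>) summable_on \<Omega> d k" for k
      using has_sum_imp_summable[OF one[of k]] by (cases "k = 0") auto
    show "(\<Sum>\<^sub>\<infinity>A\<in>\<Omega> d k. ?w k A) = 1" if "fourier_coeff f k \<noteq> 0" for k
      by (rule infsumI[OF one]) (use that f0 in auto)
    have "cmod (fourier_coeff f k) * (\<Sum>\<^sub>\<infinity>A\<in>\<Omega> d k. \<bar>?w k A\<bar>) = cmod (fourier_coeff f k)" for k
      using infsumI[OF one[of k]] f0 by (cases "k = 0") auto
    then show "polynomial_growth (\<lambda>k. cmod (fourier_coeff f k) * (\<Sum>\<^sub>\<infinity>A\<in>\<Omega> d k. \<bar>?w k A\<bar>))"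
      using f_growth by (simp only:)
    show "radon d A f \<in> periodic_distributions" for A by (rule radon_distribution[OF f])
    show "fourier_coeff (radon d A f) k = of_bool (perp k A) * of_real (?w k A) * fourier_coeff f k"
      if "A \<in> Gr d" for A k
      using f0 by (cases "k = 0") (auto simp: fourier_coeff_radon[OF f that])
  qed
  show ?thesis
    by (intro conjI ballI impI mult series radon_series) simp_all
qed

end
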